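(* Let $D \subseteq \{ z \in \mathbb{C} : \operatorname{Re} z < 1 \}$ be a convex domain such that $1 \in \partial D$. Let $(z_k)_{k\ge 1}$ and $(a_k)_{k \ge 1}$ be sequences with $$ z_k \in D, \quad a_k > 0 \quad (k \in \mathbb{N}), \qquad \sum_{k=1}^\infty a_k < \infty, $$ and let $$ f(z) = \sum_{k=1}^\infty \frac{a_k}{z - z_k}. $$ Assume that $1$ is a limit point of the set $\{ z_k : k \in \mathbb{N} \}$, and that there exist real numbers $\varepsilon > 0$ and $\lambda \geq 0$ such that $$ \sum_{k : |1 - z_k| \leq \varepsilon} |1 - z_k|^\tau < \infty \quad \text{for all } \tau > \lambda, $$ and $$ \sup \{ |\arg (1 - z_k)| : k \in \mathbb{N}, \ |1 - z_k| \leq \varepsilon \} < C(\lambda) = \frac{\pi}{2\lambda}. $$ Then there exists a sequence $(\eta_j)$ of zeros of $f$ satisfying $\eta_j \in D$ for all $j$ and $\lim_{j \to \infty} \eta_j = 1$.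
   Context: A domain is a non-empty connected open subset of $\mathbb{C}$. $\arg$ denotes the principal argument; since $\operatorname{Re}(1 - z_k) > 0$, it takes values in $(-\pi/2, \pi/2)$ at the points $1 - z_k$. When $\lambda = 0$, $C(0)$ is interpreted as $+\infty$ (so the condition on the supremum is automatically satisfied). The summability hypothesis on $|1-z_k|^\tau$ implies that $\{z_k : k \in \mathbb{N}\}$ has no limit points in the punctured disc $0 < |1 - z| < \varepsilon$ and that $f$ is meromorphic there. *)

theory Defs
  imports "HOL-Analysis.Analysis"
begin

definition domain_in_plane :: "complex set \<Rightarrow> bool" where
  "domain_in_plane D \<longleftrightarrow> D \<noteq> {} \<and> connected D \<and> open D"

(* A re-indexing of the sequences from k >= 1 to k >= 0.  Where w = z k, the k-th term is 0
   (division by zero), so the values on range z are not meaningful. *)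
definition pole_series :: "(nat \<Rightarrow> real) \<Rightarrow> (nat \<Rightarrow> complex) \<Rightarrow> complex \<Rightarrow> complex" where
  "pole_series a z w = (\<Sum>k. complex_of_real (a k) / (w - z k))"

(* For a k > 0 with convergent sum, the series converges absolutely and locally uniformly off the
   closure of range z, so f is holomorphic there.  Zeros are required to lie in this set; this
   excludes the poles z k, at which the totalised series could take the value 0. *)
definition is_zero_of_pole_series ::
    "(nat \<Rightarrow> real) \<Rightarrow> (nat \<Rightarrow> complex) \<Rightarrow> complex \<Rightarrow> bool" where
  "is_zero_of_pole_series a z w \<longleftrightarrow> w \<notin> closure (range z) \<and> pole_series a z w = 0"

definition C_bound :: "real \<Rightarrow> ereal" where
  "C_bound l = (if l = 0 then \<infinity> else ereal (pi / (2 * l)))"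

end

theory Submission
  imports Defs "HOL-Complex_Analysis.Complex_Analysis"
begin

text \<open>
  Put \<open>v = 1 - w\<close>, \<open>b\<^sub>k = 1 - z\<^sub>k\<close>, so that \<open>f(w) = g(v) = \<Sum> a\<^sub>k / (b\<^sub>k - v)\<close> has its poles in \<open>Re v > 0\<close>.
  Suppose that \<open>g\<close> has no zeros near \<open>0\<close>. Then \<open>F = 1/g\<close> is holomorphic in a punctured disc about \<open>0\<close>,
  with simple zeros at the points \<open>b\<^sub>k\<close>, and it suffices to show that \<open>F\<close> is bounded near \<open>0\<close>:
  the singularity is then removable, while the zeros accumulate there.

  Outside a sector \<open>\<bar>arg v\<bar> < s\<close> containing the poles, \<open>\<bar>g\<bar>\<close> is bounded below. For \<open>Re v \<le> 0\<close>
  this is positivity of the real part. If \<open>\<lambda> \<ge> 1\<close>, a sector with \<open>s < \<pi>/2\<close> is needed, and either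
  \<open>\<Sum> a\<^sub>k / \<bar>b\<^sub>k\<bar> < \<infinity>\<close>, when \<open>g\<close> extends continuously to \<open>0\<close> with \<open>Re g(0) > 0\<close>, or the series
  diverges and the poles near \<open>0\<close>, all on one side of a line through \<open>v\<close>, force \<open>\<bar>g(v)\<bar> \<rightarrow> \<infinity>\<close>.

  Inside the sector, choose \<open>s < t < \<pi>/(2\<lambda>)\<close>; the map \<open>\<zeta> = v\<^sup>-\<^sup>\<gamma>\<close>, \<open>\<gamma> = \<pi>/(2t)\<close>, sends \<open>\<bar>arg v\<bar> < t\<close>
  onto the right half-plane and the poles to points \<open>q\<close> with \<open>\<Sum> \<bar>q\<bar>\<^sup>-\<^sup>\<sigma> < \<infinity>\<close> for some \<open>\<sigma> < 1\<close>.
  Multiplying \<open>g\<close> by the finite product of the factors \<open>1 - \<zeta>/q\<close> removes the poles at the cost of a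
  factor \<open>exp(O(\<bar>\<zeta>\<bar>\<^sup>\<sigma>))\<close>. The product is zero-free, so Harnack's inequality for the logarithm of its
  modulus gives \<open>\<bar>F\<bar> \<le> exp(O(\<bar>\<zeta>\<bar>))\<close>. Since \<open>s < t\<close>, the Phragmen-Lindeloef principle then
  carries the bound for \<open>F\<close> from the sides of the smaller sector to its interior. Finally, the zeros lie in \<open>D\<close>
  by the Gauss-Lucas argument.
\<close>

section \<open>Harnack, Phragmen-Lindeloef and elementary estimates\<close>

lemma harnack_ball:
  fixes G :: "complex \<Rightarrow> complex"
  assumes hol: "G holomorphic_on ball c R" and pos: "\<And>u. u \<in> ball c R \<Longrightarrow> 0 < Re (G u)"
    and x: "x \<in> ball c R"
  shows "Re (G x) * (R - dist c x) \<le> Re (G c) * (R + dist c x)"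
    and "Re (G c) * (R - dist c x) \<le> Re (G x) * (R + dist c x)"
proof -
  have R: "R > 0" using x by (metis ball_eq_empty empty_iff not_le)
  define \<phi> where "\<phi> u = (G (c + of_real R * u) - G c) / (G (c + of_real R * u) + cnj (G c))" for u
  have inb: "c + of_real R * u \<in> ball c R" if "u \<in> ball 0 1" for u
    using that R by (simp add: dist_norm norm_mult)
  have cb: "c \<in> ball c R" using R by simp
  have den: "G w + cnj (G c) \<noteq> 0" if "w \<in> ball c R" for w
  proof -
    have "Re (G w + cnj (G c)) > 0" using pos[OF that] pos[OF cb] by simp
    then show ?thesis by (metis less_irrefl zero_complex.simps(1))
  qed
  have sq: "cmod (G w - G c) ^ 2 = (Re (G w) - Re (G c))^2 + (Im (G w) - Im (G c))^2"
    "cmod (G w + cnj (G c)) ^ 2 = (Re (G w) + Re (G c))^2 + (Im (G w) - Im (G c))^2" for w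
    by (simp_all add: cmod_power2)
  have lt1: "cmod (\<phi> u) < 1" if "cmod u < 1" for u
  proof -
    define w where "w = c + of_real R * u"
    have w: "w \<in> ball c R" using inb[of u] that by (simp add: w_def)
    have "cmod (G w - G c) ^ 2 < cmod (G w + cnj (G c)) ^ 2"
      unfolding sq using mult_pos_pos[OF pos[OF w] pos[OF cb]] by (simp add: power2_eq_square algebra_simps)
    then have "cmod (G w - G c) < cmod (G w + cnj (G c))"
      by (rule power2_less_imp_less) simp
    then show ?thesis using den[OF w]
      unfolding \<phi>_def w_def[symmetric] by (simp add: norm_divide divide_simps)
  qed
  have hG: "(\<lambda>u. G (c + of_real R * u)) holomorphic_on ball 0 1"
    by (rule holomorphic_on_compose_gen[OF _ hol, unfolded o_def])
       (use inb in \<open>auto intro!: holomorphic_intros\<close>)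
  have h\<phi>: "\<phi> holomorphic_on ball 0 1"
    unfolding \<phi>_def by (intro holomorphic_intros hG) (use den inb in auto)
  define u where "u = (x - c) / of_real R"
  have u: "cmod u < 1" "c + of_real R * u = x" "cmod u = dist c x / R"
    using x R by (simp_all add: u_def norm_divide dist_norm norm_minus_commute)
  have "cmod (\<phi> u) \<le> cmod u"
    by (rule Schwarz_Lemma(1)[OF h\<phi> _ lt1 u(1)]) (auto simp: \<phi>_def)
  then have "cmod (G x - G c) \<le> cmod u * cmod (G x + cnj (G c))"
    using den[OF x] unfolding \<phi>_def u(2) by (simp add: norm_divide divide_simps)
  then have "cmod (G x - G c)^2 \<le> (cmod u * cmod (G x + cnj (G c)))^2"
    by (intro power_mono) auto
  then have "(Re (G x) - Re (G c))^2 + (Im (G x) - Im (G c))^2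
     \<le> (cmod u)^2 * ((Re (G x) + Re (G c))^2 + (Im (G x) - Im (G c))^2)"
    by (simp add: sq power_mult_distrib)
  moreover have "(cmod u)^2 * (Im (G x) - Im (G c))^2 \<le> 1 * (Im (G x) - Im (G c))^2"
    using u(1) by (intro mult_right_mono power_le_one) (auto simp: power_le_one)
  ultimately have "(Re (G x) - Re (G c))^2 \<le> (cmod u * (Re (G x) + Re (G c)))^2"
    unfolding power_mult_distrib by (simp only: distrib_left mult_1_left)
  then have "\<bar>Re (G x) - Re (G c)\<bar> \<le> cmod u * (Re (G x) + Re (G c))"
    using pos[OF x] pos[OF cb] by (metis abs_le_square_iff abs_of_nonneg add_nonneg_nonneg less_imp_le mult_nonneg_nonneg norm_ge_zero)
  then have *: "R * \<bar>Re (G x) - Re (G c)\<bar> \<le> dist c x * (Re (G x) + Re (G c))"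
    using R by (simp add: u(3) field_simps)
  have "R * (Re (G x) - Re (G c)) \<le> R * \<bar>Re (G x) - Re (G c)\<bar>"
       "R * (Re (G c) - Re (G x)) \<le> R * \<bar>Re (G x) - Re (G c)\<bar>"
    using R by (intro mult_left_mono; simp)+
  with * show "Re (G x) * (R - dist c x) \<le> Re (G c) * (R + dist c x)"
    and "Re (G c) * (R - dist c x) \<le> Re (G x) * (R + dist c x)"
    by (simp_all add: algebra_simps)
qed

text \<open>On a disc \<open>q = exp g\<close>, and \<open>- ln |q|\<close> is the positive real
  part of \<open>- g\<close>. The two halves of \<open>harnack_ball\<close> compare \<open>x\<close>
  with \<open>c\<close> and \<open>c\<close> with \<open>y\<close>; each factor
  \<open>R + dist\<close> is at most \<open>2 * R\<close>.\<close>

lemma harnack_zero_free: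
  fixes q :: "complex \<Rightarrow> complex"
  assumes hol: "q holomorphic_on ball c R" and nz: "\<And>u. u \<in> ball c R \<Longrightarrow> q u \<noteq> 0"
    and lt1: "\<And>u. u \<in> ball c R \<Longrightarrow> cmod (q u) < 1"
    and x: "x \<in> ball c R" and y: "y \<in> ball c R"
  shows "- ln (cmod (q x)) * ((R - dist c x) * (R - dist c y)) \<le> - ln (cmod (q y)) * (4 * R^2)"
proof -
  have R: "R > 0" using x by (metis ball_eq_empty empty_iff not_le)
  obtain g where g: "g holomorphic_on ball c R" "\<And>u. u \<in> ball c R \<Longrightarrow> q u = exp (g u)"
    using contractible_imp_holomorphic_log[OF hol convex_imp_contractible[OF convex_ball] nz] by auto
  define G where "G u = - g u" for u
  have ReG: "Re (G u) = - ln (cmod (q u))" if "u \<in> ball c R" for u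
    using g(2)[OF that] by (simp add: G_def)
  have pos: "0 < Re (G u)" if "u \<in> ball c R" for u
    unfolding ReG[OF that] using nz[OF that] lt1[OF that] by simp
  have hG: "G holomorphic_on ball c R" unfolding G_def by (intro holomorphic_intros g)
  have d: "dist c x < R" "dist c y < R" using x y by auto
  have "Re (G x) * (R - dist c x) * (R - dist c y) \<le> Re (G c) * (R + dist c x) * (R - dist c y)"
    using harnack_ball(1)[OF hG pos x] d by (intro mult_right_mono) auto
  also have "\<dots> = Re (G c) * (R - dist c y) * (R + dist c x)" by simp
  also have "\<dots> \<le> Re (G y) * (R + dist c y) * (R + dist c x)"
    using harnack_ball(2)[OF hG pos y] R by (intro mult_right_mono) auto
  also have "\<dots> = Re (G y) * ((R + dist c y) * (R + dist c x))" by simp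
  also have "\<dots> \<le> Re (G y) * ((2 * R) * (2 * R))"
    using d pos[OF y] R by (intro mult_left_mono mult_mono) (auto intro: add_nonneg_nonneg)
  finally show ?thesis unfolding ReG[OF x] ReG[OF y] by (simp add: power2_eq_square mult_ac)
qed

text \<open>Zeros are divided out one at a time by the difference quotient \<open>H\<close> at
  \<open>p\<close>. Its value at \<open>p\<close> is the nonzero derivative, and at another zero
  \<open>r\<close> the product rule gives \<open>deriv F r = deriv H r * (r - p)\<close>, so the
  remaining zeros stay simple.\<close>

lemma factor_simple_zeros:
  fixes F :: "complex \<Rightarrow> complex"
  assumes "finite S" and "open U" and "S \<subseteq> U" and "F holomorphic_on U"
    and "\<And>u. u \<in> U \<Longrightarrow> F u = 0 \<longleftrightarrow> u \<in> S" and "\<And>p. p \<in> S \<Longrightarrow> deriv F p \<noteq> 0"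
  shows "\<exists>k. k holomorphic_on U \<and> (\<forall>u\<in>U. k u \<noteq> 0 \<and> F u = k u * (\<Prod>p\<in>S. u - p))"
  using assms(1,3-)
proof (induction S arbitrary: F rule: finite_induct)
  case empty
  then show ?case by (intro exI[of _ F]) auto
next
  case (insert p S)
  define H where "H u = (if u = p then deriv F p else (F u - F p) / (u - p))" for u
  have Fp: "F p = 0" using insert.prems by auto
  have hH: "H holomorphic_on U"
    unfolding H_def using pole_lemma_open[OF insert.prems(2) \<open>open U\<close>] by simp
  have FH: "F u = H u * (u - p)" for u using Fp by (simp add: H_def)
  have zH: "H u = 0 \<longleftrightarrow> u \<in> S" if "u \<in> U" for u
    using insert.prems(3)[OF that] insert.prems(4)[of p] \<open>p \<notin> S\<close> Fp by (auto simp: H_def)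
  have dH: "deriv H r \<noteq> 0" if "r \<in> S" for r
  proof -
    have rU: "r \<in> U" using that insert.prems by auto
    have "(H has_field_derivative deriv H r) (at r)"
      using hH rU \<open>open U\<close> holomorphic_derivI by blast
    then have "((\<lambda>u. H u * (u - p)) has_field_derivative deriv H r * (r - p) + H r) (at r)"
      by (auto intro!: derivative_eq_intros)
    then have "deriv F r = deriv H r * (r - p) + H r"
      unfolding FH[symmetric] by (rule DERIV_imp_deriv)
    moreover have "H r = 0" using zH rU that by auto
    ultimately show ?thesis using insert.prems(4)[of r] that by auto
  qed
  from insert.IH[OF _ hH zH dH] insert.prems(1)
  obtain k where k: "k holomorphic_on U" "\<forall>u\<in>U. k u \<noteq> 0 \<and> H u = k u * (\<Prod>p\<in>S. u - p)" by auto
  then show ?case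
    using insert.hyps by (intro exI[of _ k]) (auto simp: FH)
qed

text \<open>The auxiliary factor is \<open>exp (- \<delta> * exp (\<gamma>' * u))\<close> with
  \<open>\<gamma>'\<close> between \<open>\<gamma>\<close> and \<open>pi / (2 * s)\<close>. On the
  strip \<open>cos (\<gamma>' * Im u)\<close> is bounded below, so the factor beats the permitted
  growth; the maximum principle on long rectangles and then \<open>\<delta> \<rightarrow> 0\<close>
  finish.\<close>

lemma phragmen_lindelof_half_strip:
  fixes F :: "complex \<Rightarrow> complex"
  assumes hol: "F holomorphic_on U" "open U" and U: "\<And>x. x0 \<le> Re x \<Longrightarrow> \<bar>Im x\<bar> \<le> s \<Longrightarrow> x \<in> U"
    and s: "0 < s" "\<gamma> * s < pi / 2" and \<gamma>: "0 < \<gamma>" and C: "0 \<le> C" and B: "0 < B"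
    and side: "\<And>x. x0 \<le> Re x \<Longrightarrow> \<bar>Im x\<bar> = s \<Longrightarrow> cmod (F x) \<le> B"
    and base: "\<And>x. x0 = Re x \<Longrightarrow> \<bar>Im x\<bar> \<le> s \<Longrightarrow> cmod (F x) \<le> B"
    and growth: "\<And>x. x0 \<le> Re x \<Longrightarrow> \<bar>Im x\<bar> \<le> s \<Longrightarrow> cmod (F x) \<le> exp (C * exp (\<gamma> * Re x))"
    and x: "x0 \<le> Re x" "\<bar>Im x\<bar> \<le> s"
  shows "cmod (F x) \<le> B"
proof -
  define \<gamma>' where "\<gamma>' = (\<gamma> + pi / (2 * s)) / 2"
  have g1: "\<gamma> < pi / (2 * s)" using s by (simp add: field_simps)
  have g2: "\<gamma> < \<gamma>'" "\<gamma>' < pi / (2 * s)" using g1 by (auto simp: \<gamma>'_def)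
  have g3: "\<gamma>' * s < pi / 2" using g2 s by (simp add: field_simps)
  have g0: "\<gamma>' > 0" using g2 \<gamma> by simp
  define c where "c = cos (\<gamma>' * s)"
  have c: "c > 0" unfolding c_def using g3 mult_pos_pos[OF g0 s(1)] by (intro cos_gt_zero_pi) auto
  have cosge: "cos (\<gamma>' * y) \<ge> c" if "\<bar>y\<bar> \<le> s" for y
  proof -
    have "\<gamma>' * s \<ge> \<gamma>' * \<bar>y\<bar>" using that g0 by (intro mult_left_mono) auto
    then have "cos (\<gamma>' * \<bar>y\<bar>) \<ge> c" unfolding c_def using g0 order_trans[OF less_imp_le[OF g3], of pi]
      by (intro cos_monotone_0_pi_le) auto
    then show ?thesis by (cases "y \<ge> 0") auto
  qed
  have main: "cmod (F x) * exp (- \<delta> * exp (\<gamma>' * Re x) * cos (\<gamma>' * Im x)) \<le> B" if \<delta>: "\<delta> > 0" for \<delta>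
  proof -
    define H where "H u = F u * exp (- of_real \<delta> * exp (of_real \<gamma>' * u))" for u
    have nH: "cmod (H u) = cmod (F u) * exp (- \<delta> * exp (\<gamma>' * Re u) * cos (\<gamma>' * Im u))" for u
      by (simp add: H_def norm_mult Re_exp)
    have nH2: "cmod (H u) \<le> cmod (F u) * exp (- \<delta> * c * exp (\<gamma>' * Re u))" if "\<bar>Im u\<bar> \<le> s" for u
      unfolding nH using cosge[OF that] \<delta> by (intro mult_left_mono) (auto simp: mult_ac)
    have hH: "H holomorphic_on U" unfolding H_def by (intro holomorphic_intros hol)
    have "eventually (\<lambda>X. exp (C * exp (\<gamma> * X)) * exp (- \<delta> * c * exp (\<gamma>' * X)) \<le> B) at_top"
    proof -
      have "((\<lambda>X. exp (- exp (\<gamma> * X) * (\<delta> * c * exp ((\<gamma>' - \<gamma>) * X) - C))) \<longlongrightarrow> 0) at_top"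
      proof (rule filterlim_compose[OF exp_at_bot])
        have "filterlim (\<lambda>X. \<delta> * c * exp ((\<gamma>' - \<gamma>) * X) - C) at_top at_top"
        proof -
          have "filterlim (\<lambda>X. (\<gamma>' - \<gamma>) * X) at_top at_top"
            using g2 by (intro filterlim_tendsto_pos_mult_at_top[OF tendsto_const]) (auto simp: filterlim_ident)
          then have "filterlim (\<lambda>X. exp ((\<gamma>' - \<gamma>) * X)) at_top at_top"
            by (rule filterlim_compose[OF exp_at_top])
          then have "filterlim (\<lambda>X. (\<delta> * c) * exp ((\<gamma>' - \<gamma>) * X)) at_top at_top"
            using \<delta> c by (intro filterlim_tendsto_pos_mult_at_top[OF tendsto_const]) auto
          then have "filterlim (\<lambda>X. (- C) + (\<delta> * c) * exp ((\<gamma>' - \<gamma>) * X)) at_top at_top"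
            by (rule filterlim_tendsto_add_at_top[OF tendsto_const])
          then show ?thesis by (simp add: algebra_simps)
        qed
        moreover have "filterlim (\<lambda>X. exp (\<gamma> * X)) at_top at_top"
          using \<gamma> by (intro filterlim_compose[OF exp_at_top] filterlim_tendsto_pos_mult_at_top[OF tendsto_const]) (auto simp: filterlim_ident)
        ultimately have "filterlim (\<lambda>X. exp (\<gamma> * X) * (\<delta> * c * exp ((\<gamma>' - \<gamma>) * X) - C)) at_top at_top"
          by (intro filterlim_at_top_mult_at_top)
        then show "filterlim (\<lambda>X. - exp (\<gamma> * X) * (\<delta> * c * exp ((\<gamma>' - \<gamma>) * X) - C)) at_bot at_top"
          by (simp add: filterlim_uminus_at_bot)
      qed
      then have "eventually (\<lambda>X. exp (- exp (\<gamma> * X) * (\<delta> * c * exp ((\<gamma>' - \<gamma>) * X) - C)) < B) at_top"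
        using B \<delta> by (intro order_tendstoD) auto
      then show ?thesis
      proof (rule eventually_mono)
        fix X assume *: "exp (- exp (\<gamma> * X) * (\<delta> * c * exp ((\<gamma>' - \<gamma>) * X) - C)) < B"
        have "exp (\<gamma> * X) * exp ((\<gamma>' - \<gamma>) * X) = exp (\<gamma>' * X)"
          by (simp add: exp_add[symmetric] algebra_simps)
        then have "- exp (\<gamma> * X) * (\<delta> * c * exp ((\<gamma>' - \<gamma>) * X) - C) = C * exp (\<gamma> * X) + (- \<delta> * c * exp (\<gamma>' * X))"
          by (simp add: algebra_simps)
        with * show "exp (C * exp (\<gamma> * X)) * exp (- \<delta> * c * exp (\<gamma>' * X)) \<le> B"
          by (simp only: exp_add less_imp_le)
      qed
    qed
    then obtain X0 where X0: "\<And>X. X \<ge> X0 \<Longrightarrow> exp (C * exp (\<gamma> * X)) * exp (- \<delta> * c * exp (\<gamma>' * X)) \<le> B"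
      by (auto simp: eventually_at_top_linorder)
    define X where "X = max X0 (Re x + 1)"
    define Q where "Q = cbox (Complex x0 (- s)) (Complex X s)"
    have Qmem: "u \<in> Q \<longleftrightarrow> x0 \<le> Re u \<and> Re u \<le> X \<and> \<bar>Im u\<bar> \<le> s" for u
      by (auto simp: Q_def in_cbox_complex_iff)
    have QU: "Q \<subseteq> U" using U Qmem by auto
    have "cmod (H x) \<le> B"
    proof (rule maximum_modulus_frontier[of H Q])
      show "H holomorphic_on interior Q"
        using hH QU interior_subset by (meson holomorphic_on_subset order_trans)
      show "continuous_on (closure Q) H"
        using holomorphic_on_imp_continuous_on[OF hH] QU
        by (metis Q_def closed_cbox closure_closed continuous_on_subset)
      show "bounded Q" by (simp add: Q_def)
      show "x \<in> Q" using x by (auto simp: Qmem X_def)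
      fix u assume "u \<in> frontier Q"
      then have uQ: "u \<in> Q" and "u \<notin> box (Complex x0 (- s)) (Complex X s)"
        by (auto simp: Q_def frontier_cbox)
      then consider "Re u = x0" | "\<bar>Im u\<bar> = s" | "Re u = X"
        by (auto simp: Qmem in_box_complex_iff)
      then show "cmod (H u) \<le> B"
      proof cases
        case 3
        have "cmod (H u) \<le> exp (C * exp (\<gamma> * Re u)) * exp (- \<delta> * c * exp (\<gamma>' * Re u))"
          using uQ by (intro order_trans[OF nH2] mult_right_mono growth) (auto simp: Qmem)
        also have "\<dots> \<le> B" using X0[of "Re u"] 3 by (simp add: X_def)
        finally show ?thesis .
      next
        case 1
        have "cmod (H u) \<le> B * 1"
          using uQ 1 \<delta> c B by (intro order_trans[OF nH2] mult_mono base) (auto simp: Qmem)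
        then show ?thesis by simp
      next
        case 2
        have "cmod (H u) \<le> B * 1"
          using uQ 2 \<delta> c B by (intro order_trans[OF nH2] mult_mono side) (auto simp: Qmem)
        then show ?thesis by simp
      qed
    qed
    then show ?thesis unfolding nH .
  qed
  have "((\<lambda>\<delta>. cmod (F x) * exp (- \<delta> * exp (\<gamma>' * Re x) * cos (\<gamma>' * Im x))) \<longlongrightarrow> cmod (F x) * exp (- 0 * exp (\<gamma>' * Re x) * cos (\<gamma>' * Im x))) (at_right 0)"
    by (intro tendsto_intros)
  then have "cmod (F x) * exp (- 0 * exp (\<gamma>' * Re x) * cos (\<gamma>' * Im x)) \<le> B"
    by (rule tendsto_upperbound) (use main in \<open>auto intro!: eventually_mono[OF eventually_at_right_less[of 0]]\<close>)
  then show ?thesis by simp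
qed

text \<open>\<open>(exp u - 1) / u\<close>, with its value 1 filled in at 0, is continuous, and its
  zeros, the nonzero multiples of \<open>2 * pi * \<i>\<close>, miss the compact rectangle because
  \<open>m < 2 * pi\<close>. Its minimum modulus there is the constant.\<close>

lemma norm_exp_minus_1_ge:
  assumes "0 < m" "m < 2 * pi"
  shows "\<exists>c>0. \<forall>u. \<bar>Re u\<bar> \<le> 1 \<longrightarrow> \<bar>Im u\<bar> \<le> m \<longrightarrow> cmod (exp u - 1) \<ge> c * cmod u"
proof -
  define Q where "Q = cbox (Complex (-1) (- m)) (Complex 1 m)"
  have Qmem: "u \<in> Q \<longleftrightarrow> \<bar>Re u\<bar> \<le> 1 \<and> \<bar>Im u\<bar> \<le> m" for u
    by (auto simp: Q_def in_cbox_complex_iff)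
  define h where "h u = (if u = 0 then deriv exp 0 else (exp u - exp 0) / (u - 0))" for u :: complex
  have "h holomorphic_on UNIV"
    unfolding h_def by (rule pole_lemma_open) (auto intro!: holomorphic_intros)
  then have "continuous_on Q (\<lambda>u. cmod (h u))"
    by (intro continuous_on_norm) (meson holomorphic_on_imp_continuous_on continuous_on_subset subset_UNIV)
  moreover have "compact Q" "Q \<noteq> {}" using Qmem[of 0] assms by (auto simp: Q_def)
  ultimately obtain p where p: "p \<in> Q" "\<And>u. u \<in> Q \<Longrightarrow> cmod (h p) \<le> cmod (h u)"
    using continuous_attains_inf[of Q "\<lambda>u. cmod (h u)"] by blast
  have "h p \<noteq> 0"
  proof (cases "p = 0")
    case True
    then show ?thesis by (simp add: h_def DERIV_imp_deriv[OF DERIV_exp])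
  next
    case False
    have "exp p \<noteq> 1"
    proof
      assume "exp p = 1"
      then obtain n :: int where n: "Re p = 0" "Im p = of_int (2 * n) * pi" by (auto simp: exp_eq_1)
      then have "n \<noteq> 0" using False by (auto simp: complex_eq_iff)
      then have "\<bar>of_int n\<bar> \<ge> (1::real)" by linarith
      then have "2 * \<bar>of_int n\<bar> * pi \<ge> 2 * 1 * pi" by (intro mult_right_mono mult_left_mono) auto
      then have "\<bar>Im p\<bar> \<ge> 2 * pi" unfolding n(2) by (simp add: abs_mult)
      then show False using p(1) assms by (auto simp: Qmem)
    qed
    then show ?thesis using False by (simp add: h_def)
  qed
  moreover have "cmod (exp u - 1) \<ge> cmod (h p) * cmod u" if "\<bar>Re u\<bar> \<le> 1" "\<bar>Im u\<bar> \<le> m" for u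
  proof -
    have "cmod (exp u - 1) = cmod (h u) * cmod u" by (simp add: h_def norm_divide)
    then show ?thesis using p(2)[of u] that by (simp add: Qmem mult_right_mono)
  qed
  ultimately show ?thesis by (intro exI[of _ "cmod (h p)"]) auto
qed

text \<open>Provides a line with the poles, in the sector \<open>p\<close>, on one side and a point
  outside the sector \<open>s\<close> on the other. Tilting the normal by \<open>e\<close> or
  \<open>- e\<close> shares the gap \<open>s - p\<close> equally; the margin is \<open>sin d\<close>
  with \<open>d\<close> half the gap.\<close>

lemma separating_direction:
  fixes p s :: real
  assumes "0 \<le> p" "p < s" "s < pi / 2"
  shows "\<exists>c>0. \<forall>y. s \<le> \<bar>y\<bar> \<longrightarrow> \<bar>y\<bar> \<le> pi \<longrightarrow> (\<exists>\<alpha>. (\<forall>x. \<bar>x\<bar> \<le> p \<longrightarrow> c \<le> cos (x - \<alpha>)) \<and> cos (y - \<alpha>) \<le> - c)"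
proof -
  define d where "d = (s - p) / 2"
  define e where "e = pi / 2 - (s + p) / 2"
  have d: "0 < d" "d < pi / 2" using assms by (auto simp: d_def)
  have c: "cos (pi / 2 - d) > 0" using d by (intro cos_gt_zero) auto
  have cosge: "cos x \<ge> cos (pi / 2 - d)" if "\<bar>x\<bar> \<le> pi / 2 - d" for x
  proof -
    have "cos \<bar>x\<bar> \<ge> cos (pi / 2 - d)" using that d by (intro cos_monotone_0_pi_le) auto
    then show ?thesis by (cases "x \<ge> 0") auto
  qed
  have *: "cos (x + e) \<ge> cos (pi / 2 - d)" "cos (x - e) \<ge> cos (pi / 2 - d)" if "\<bar>x\<bar> \<le> p" for x
  proof -
    have "\<bar>x + e\<bar> \<le> pi / 2 - d" using that assms unfolding d_def e_def abs_le_iff by argo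
    moreover have "\<bar>x - e\<bar> \<le> pi / 2 - d" using that assms unfolding d_def e_def abs_le_iff by argo
    ultimately show "cos (x + e) \<ge> cos (pi / 2 - d)" "cos (x - e) \<ge> cos (pi / 2 - d)"
      by (simp_all add: cosge)
  qed
  have **: "cos (y + e) \<le> - cos (pi / 2 - d)" if "s \<le> y" "y \<le> pi" for y
  proof -
    have "cos (y + e - pi) \<ge> cos (pi / 2 - d)"
      using that assms by (intro cosge) (unfold d_def e_def abs_le_iff, argo)
    then show ?thesis by (simp add: cos_diff)
  qed
  show ?thesis
  proof (rule exI[of _ "cos (pi / 2 - d)"], intro conjI allI impI)
    fix y :: real assume y: "s \<le> \<bar>y\<bar>" "\<bar>y\<bar> \<le> pi"
    show "\<exists>\<alpha>. (\<forall>x. \<bar>x\<bar> \<le> p \<longrightarrow> cos (pi / 2 - d) \<le> cos (x - \<alpha>)) \<and> cos (y - \<alpha>) \<le> - cos (pi / 2 - d)"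
    proof (cases "y \<ge> 0")
      case True
      then show ?thesis using * ** y by (intro exI[of _ "- e"]) auto
    next
      case False
      then have "cos (- y + e) \<le> - cos (pi / 2 - d)" using y by (intro **) auto
      then have "cos (y - e) \<le> - cos (pi / 2 - d)" by (metis cos_minus minus_diff_eq uminus_add_conv_diff)
      then show ?thesis using * by (intro exI[of _ e]) auto
    qed
  qed (rule c)
qed

section \<open>Growth of products from sums of powers\<close>

lemma ln_1_plus_le_powr:
  fixes x \<sigma> :: real
  assumes "0 \<le> x" "0 < \<sigma>" "\<sigma> \<le> 1"
  shows "ln (1 + x) \<le> (1 + 1 / \<sigma>) * x powr \<sigma>"
proof (cases "x \<le> 1")
  case True
  show ?thesis
  proof (cases "x = 0")
    case False
    have "ln (1 + x) \<le> x" using assms by (intro ln_add_one_self_le_self) auto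
    also have "x = x powr 1" using assms by simp
    also have "\<dots> \<le> x powr \<sigma>" using assms True False by (intro powr_mono') auto
    also have "\<dots> \<le> (1 + 1 / \<sigma>) * x powr \<sigma>" using assms by (simp add: distrib_right)
    finally show ?thesis .
  qed simp
next
  case False
  have "ln (1 + x) \<le> ln (2 * x)" using False by simp
  also have "\<dots> = ln 2 + ln x" using False by (simp add: ln_mult)
  also have "ln 2 \<le> (1::real)" using ln_2_less_1 by simp
  also have "ln x \<le> x powr \<sigma> / \<sigma>" using False assms by (intro ln_powr_bound) auto
  also have "1 \<le> x powr \<sigma>" using False assms by (intro ge_one_powr_ge_zero) auto
  finally show ?thesis by (simp add: distrib_right)
qed

lemma prod_1_plus_le_exp_powr:
  fixes f :: "'a \<Rightarrow> real"
  assumes "\<And>i. i \<in> S \<Longrightarrow> 0 \<le> f i" "0 < \<sigma>" "\<sigma> \<le> 1"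
  shows "(\<Prod>i\<in>S. 1 + f i) \<le> exp ((1 + 1 / \<sigma>) * (\<Sum>i\<in>S. f i powr \<sigma>))"
proof (cases "finite S")
  case True
  have "(\<Prod>i\<in>S. 1 + f i) \<le> (\<Prod>i\<in>S. exp ((1 + 1 / \<sigma>) * f i powr \<sigma>))"
  proof (intro prod_mono conjI)
    fix i assume "i \<in> S"
    then have "1 + f i > 0" using assms(1)[of i] by linarith
    then have "1 + f i = exp (ln (1 + f i))" by simp
    also have "\<dots> \<le> exp ((1 + 1 / \<sigma>) * f i powr \<sigma>)"
      using ln_1_plus_le_powr[of "f i" \<sigma>] assms \<open>i \<in> S\<close> by simp
    finally show "1 + f i \<le> exp ((1 + 1 / \<sigma>) * f i powr \<sigma>)" .
    show "0 \<le> 1 + f i" using \<open>1 + f i > 0\<close> by simp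
  qed
  also have "\<dots> = exp ((1 + 1 / \<sigma>) * (\<Sum>i\<in>S. f i powr \<sigma>))"
    using True by (simp add: exp_sum sum_distrib_left)
  finally show ?thesis .
qed auto

text \<open>Weierstrass M-test with majorant \<open>|a k| / d\<close>. The distance is required only
  where \<open>a k \<noteq> 0\<close>, so that poles can be removed by setting their coefficients to
  zero without reindexing.\<close>

lemma pole_sum_holomorphic:
  fixes a :: "nat \<Rightarrow> real" and b :: "nat \<Rightarrow> complex"
  assumes "summable (\<lambda>k. \<bar>a k\<bar>)" "open U" "d > 0"
    and "\<And>k v. a k \<noteq> 0 \<Longrightarrow> v \<in> U \<Longrightarrow> d \<le> cmod (b k - v)"
  shows "(\<lambda>v. \<Sum>k. of_real (a k) / (b k - v)) holomorphic_on U"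
    and "\<And>v. v \<in> U \<Longrightarrow> summable (\<lambda>k. of_real (a k) / (b k - v))"
proof -
  have le: "cmod (of_real (a k) / (b k - v)) \<le> \<bar>a k\<bar> / d" if "v \<in> U" for k v
    using assms(3) assms(4)[of k v] that
    by (cases "a k = 0") (auto simp: norm_divide intro!: divide_left_mono mult_pos_pos)
  have su: "summable (\<lambda>k. \<bar>a k\<bar> / d)" using assms by (intro summable_divide)
  show "summable (\<lambda>k. of_real (a k) / (b k - v))" if "v \<in> U" for v
    using le[OF that] by (intro summable_comparison_test'[OF su]) auto
  have unif: "uniform_limit U (\<lambda>n v. \<Sum>k<n. of_real (a k) / (b k - v)) (\<lambda>v. \<Sum>k. of_real (a k) / (b k - v)) sequentially"
    by (rule Weierstrass_m_test[OF le su])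
  show "(\<lambda>v. \<Sum>k. of_real (a k) / (b k - v)) holomorphic_on U"
  proof (rule holomorphic_uniform_sequence[OF \<open>open U\<close>])
    fix n
    have "(\<lambda>v. of_real (a k) / (b k - v)) holomorphic_on U" for k
    proof (cases "a k = 0")
      case False
      then have "b k - v \<noteq> 0" if "v \<in> U" for v using assms(3) assms(4)[of k v] that by auto
      then show ?thesis by (intro holomorphic_intros) auto
    qed auto
    then show "(\<lambda>v. \<Sum>k<n. of_real (a k) / (b k - v)) holomorphic_on U"
      by (intro holomorphic_on_sum)
  next
    fix x assume "x \<in> U"
    then obtain e where "e > 0" "cball x e \<subseteq> U" using \<open>open U\<close> open_contains_cball by blast
    then show "\<exists>d. 0 < d \<and> cball x d \<subseteq> U \<and> uniform_limit (cball x d) (\<lambda>n v. \<Sum>k<n. of_real (a k) / (b k - v)) (\<lambda>v. \<Sum>k. of_real (a k) / (b k - v)) sequentially"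
      using uniform_limit_on_subset[OF unif] by blast
  qed
qed

lemma finite_large_terms_of_summable_on:
  fixes f :: "'a \<Rightarrow> real"
  assumes "f summable_on A" "\<And>x. x \<in> A \<Longrightarrow> 0 \<le> f x" "0 < c"
  shows "finite {x \<in> A. c \<le> f x}"
proof (rule ccontr)
  assume "infinite {x \<in> A. c \<le> f x}"
  define n where "n = nat \<lceil>infsum f A / c\<rceil> + 1"
  obtain B where B: "finite B" "card B = n" "B \<subseteq> {x \<in> A. c \<le> f x}"
    using infinite_arbitrarily_large \<open>infinite _\<close> by blast
  have "real n * c \<le> sum f B" using sum_bounded_below[of B c f] B by auto
  also have "\<dots> \<le> infsum f A" using B assms by (intro finite_sum_le_infsum) auto
  finally have "real n \<le> infsum f A / c" using assms by (simp add: field_simps)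
  moreover have "infsum f A / c < real n" unfolding n_def by linarith
  ultimately show False by simp
qed

section \<open>Sums of simple poles and their reciprocals\<close>

locale pole_sum =
  fixes a :: "nat \<Rightarrow> real" and b :: "nat \<Rightarrow> complex" and \<epsilon> \<tau> :: real
  assumes a_pos: "\<And>k. 0 < a k" and a_sum: "summable a"
    and b_re: "\<And>k. 0 < Re (b k)"
    and eps: "0 < \<epsilon>" "\<epsilon> \<le> 1" and \<tau>: "0 < \<tau>"
    and b_sum: "(\<lambda>k. cmod (b k) powr \<tau>) summable_on {k. cmod (b k) \<le> \<epsilon>}"
begin

definition g :: "complex \<Rightarrow> complex" where
  "g v = (\<Sum>k. of_real (a k) / (b k - v))"

lemma b_nz: "b k \<noteq> 0"
  using b_re[of k] by auto

text \<open>Each such index contributes at least \<open>\<rho> powr \<tau>\<close> to the summable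
  family in \<open>b_sum\<close>.\<close>

lemma finite_annulus:
  assumes "0 < \<rho>" shows "finite {k. \<rho> \<le> cmod (b k) \<and> cmod (b k) \<le> \<epsilon>}"
proof -
  have "finite {k \<in> {k. cmod (b k) \<le> \<epsilon>}. \<rho> powr \<tau> \<le> cmod (b k) powr \<tau>}"
    by (rule finite_large_terms_of_summable_on[OF b_sum]) (use assms in auto)
  then show ?thesis
    by (rule finite_subset[rotated]) (use assms \<tau> in \<open>auto intro!: powr_mono2\<close>)
qed

lemma isolated:
  assumes "0 < cmod x" "cmod x < \<epsilon>"
  shows "\<exists>d>0. \<forall>k. b k \<noteq> x \<longrightarrow> d \<le> dist x (b k)"
proof -
  obtain d where d: "d > 0" "\<And>y. y \<in> b ` {k. cmod x / 2 \<le> cmod (b k) \<and> cmod (b k) \<le> \<epsilon>} \<Longrightarrow> y \<noteq> x \<Longrightarrow> d \<le> dist x y"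
    using finite_set_avoid[OF finite_imageI[OF finite_annulus], of "cmod x / 2" b x] assms by auto
  show ?thesis
  \<comment> \<open>Poles in the annulus from \<open>cmod x / 2\<close> to \<open>\<epsilon>\<close>
    are finite in number and handled by \<open>d\<close>; the other two terms bound the distance to
    poles inside and beyond the annulus.\<close>
  proof (intro exI[of _ "min d (min (cmod x / 2) (\<epsilon> - cmod x))"] conjI allI impI)
    fix k assume k: "b k \<noteq> x"
    have t: "cmod (b k) \<le> cmod x + dist x (b k)" "cmod x \<le> cmod (b k) + dist x (b k)"
      using norm_triangle_ineq2[of "b k" x] norm_triangle_ineq2[of x "b k"] by (auto simp: dist_norm norm_minus_commute)
    show "min d (min (cmod x / 2) (\<epsilon> - cmod x)) \<le> dist x (b k)"
    proof (cases "cmod x / 2 \<le> cmod (b k) \<and> cmod (b k) \<le> \<epsilon>")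
      case True
      then show ?thesis using d(2)[of "b k"] k by auto
    next
      case False
      then show ?thesis using t by linarith
    qed
  qed (use d assms in auto)
qed

text \<open>The coefficients are split into those sitting at \<open>x\<close> and the rest. Being
  positive, coefficients of coinciding poles cannot cancel, so their total \<open>A\<close> is
  positive. The identity also holds at \<open>v = x\<close>, where division by zero makes every
  singular term 0.\<close>

lemma local_form:
  assumes "0 < cmod x" "cmod x < \<epsilon>"
  shows "\<exists>d>0. \<exists>A G. G holomorphic_on ball x d \<and> (\<forall>v\<in>ball x d. g v = of_real A / (x - v) + G v)
    \<and> (if x \<in> range b then 0 < A else A = 0) \<and> (\<forall>k. b k \<in> ball x d \<longrightarrow> b k = x)"
proof -
  obtain d where d: "d > 0" "\<And>k. b k \<noteq> x \<Longrightarrow> d \<le> dist x (b k)"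
    using isolated[OF assms] by blast
  define a1 where "a1 k = (if b k = x then a k else 0)" for k
  define a2 where "a2 k = (if b k = x then 0 else a k)" for k
  have a1: "summable a1" and a2: "summable (\<lambda>k. \<bar>a2 k\<bar>)"
    using a_pos by (intro summable_comparison_test'[OF a_sum, of 0]; simp add: a1_def a2_def less_imp_le)+
  have dd: "d / 2 \<le> cmod (b k - v)" if "a2 k \<noteq> 0" "v \<in> ball x (d / 2)" for k v
  proof -
    have "d \<le> dist x (b k)" using that d by (auto simp: a2_def split: if_splits)
    then show ?thesis using that(2) dist_triangle[of x "b k" v]
      by (auto simp: dist_norm norm_minus_commute)
  qed
  note H = pole_sum_holomorphic[OF a2 open_ball _ dd]
  have eq: "g v = of_real (suminf a1) / (x - v) + (\<Sum>k. of_real (a2 k) / (b k - v))" if v: "v \<in> ball x (d / 2)" for v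
  proof -
    have s1: "(\<lambda>k. of_real (a1 k) / (x - v)) sums (of_real (suminf a1) / (x - v))"
      using a1 by (intro sums_divide sums_of_real summable_sums)
    have s2: "(\<lambda>k. of_real (a2 k) / (b k - v)) sums (\<Sum>k. of_real (a2 k) / (b k - v))"
      using H(2)[OF _ _ _ v] d by (intro summable_sums) auto
    have "(\<lambda>k. of_real (a1 k) / (x - v) + of_real (a2 k) / (b k - v)) = (\<lambda>k. of_real (a k) / (b k - v))"
      by (auto simp: a1_def a2_def)
    with sums_add[OF s1 s2] show ?thesis unfolding g_def by (simp add: sums_iff)
  qed
  have "if x \<in> range b then 0 < suminf a1 else suminf a1 = 0"
  proof (cases "x \<in> range b")
    case True
    then obtain k where "b k = x" by auto
    then have "0 < suminf a1" using a_pos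
      by (intro suminf_pos2[OF a1, of k]) (auto simp: a1_def less_imp_le)
    then show ?thesis using True by simp
  next
    case False
    then have "a1 = (\<lambda>_. 0)" by (force simp: a1_def)
    then show ?thesis using False by simp
  qed
  moreover have "(\<lambda>v. \<Sum>k. of_real (a2 k) / (b k - v)) holomorphic_on ball x (d / 2)"
    using H(1) d by auto
  moreover have "b k \<in> ball x (d / 2) \<longrightarrow> b k = x" for k using d(2)[of k] d(1) by force
  ultimately have C: "(\<lambda>v. \<Sum>k. of_real (a2 k) / (b k - v)) holomorphic_on ball x (d / 2)
    \<and> (\<forall>v\<in>ball x (d / 2). g v = of_real (suminf a1) / (x - v) + (\<Sum>k. of_real (a2 k) / (b k - v)))
    \<and> (if x \<in> range b then 0 < suminf a1 else suminf a1 = 0) \<and> (\<forall>k. b k \<in> ball x (d / 2) \<longrightarrow> b k = x)"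
    using eq by (intro conjI ballI allI) assumption+
  have d2: "d / 2 > 0" using d(1) by simp
  show ?thesis
    by (rule exI[of _ "d / 2"], rule conjI[OF d2], rule exI[of _ "suminf a1"],
        rule exI[of _ "\<lambda>v. \<Sum>k. of_real (a2 k) / (b k - v)"], rule C)
qed

text \<open>The reciprocal of \<open>g\<close>, with its removable singularities at the poles filled in.\<close>

definition F :: "complex \<Rightarrow> complex" where
  "F v = (if v \<in> range b then 0 else 1 / g v)"

text \<open>Near a pole \<open>F v = (x - v) / (A + (x - v) * G v)\<close> with
  \<open>A \<noteq> 0\<close>, so the zero is simple with derivative \<open>- 1 / A\<close>; off the
  poles \<open>F\<close> is locally \<open>1 / G\<close>.\<close>

lemma F_derivative:
  assumes "0 < cmod x" "cmod x < \<epsilon>" and "x \<in> range b \<or> g x \<noteq> 0"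
  shows "F field_differentiable at x" and "x \<in> range b \<Longrightarrow> deriv F x \<noteq> 0"
proof -
  obtain d A G where d: "d > 0" and G: "G holomorphic_on ball x d"
    and eq: "\<And>v. v \<in> ball x d \<Longrightarrow> g v = of_real A / (x - v) + G v"
    and A: "if x \<in> range b then 0 < A else A = 0" and iso: "\<And>k. b k \<in> ball x d \<Longrightarrow> b k = x"
    using local_form[OF assms(1,2)] by metis
  have dG: "(G has_field_derivative deriv G x) (at x)"
    using G d by (intro holomorphic_derivI[of _ "ball x d"]) auto
  have R: "(F has_field_derivative - 1 / of_real A) (at x)" if x: "x \<in> range b"
  proof -
    have A0: "A \<noteq> 0" using A x by auto
    have "((\<lambda>v. (x - v) / (of_real A + (x - v) * G v)) has_field_derivative - 1 / of_real A) (at x)"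
      using A0 by (auto intro!: derivative_eq_intros dG)
    then show ?thesis
    proof (rule has_field_derivative_transform_within_open[OF _ open_ball[of x d]])
      fix v assume v: "v \<in> ball x d"
      show "(x - v) / (of_real A + (x - v) * G v) = F v"
      proof (cases "v = x")
        case False
        then have "v \<notin> range b" using iso v by auto
        moreover have "of_real A + (x - v) * G v = g v * (x - v)"
          using False eq[OF v] by (simp add: field_simps)
        ultimately show ?thesis using False by (simp add: F_def)
      qed (use x in \<open>auto simp: F_def\<close>)
    qed (use d in auto)
  qed
  then show "x \<in> range b \<Longrightarrow> deriv F x \<noteq> 0" using A by (auto dest!: DERIV_imp_deriv)
  show "F field_differentiable at x"
  proof (cases "x \<in> range b")
    case True
    then show ?thesis using R field_differentiable_def by blast
  next
    case False
    then have Gx: "G x \<noteq> 0" using eq[of x] d assms(3) by auto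
    have "((\<lambda>v. 1 / G v) has_field_derivative - deriv G x / (G x)^2) (at x)"
      using Gx by (auto intro!: derivative_eq_intros dG simp: power2_eq_square)
    then have "(F has_field_derivative - deriv G x / (G x)^2) (at x)"
    proof (rule has_field_derivative_transform_within_open[OF _ open_ball[of x d]])
      fix v assume v: "v \<in> ball x d"
      then have "v \<notin> range b" using iso False by auto
      then show "1 / G v = F v" using eq[OF v] A False by (simp add: F_def)
    qed (use d in auto)
    then show ?thesis using field_differentiable_def by blast
  qed
qed

end

section \<open>Growth in a zero-free sector\<close>

locale zero_free_pole_sum = pole_sum +
  fixes p s t c0 :: real
  assumes nozero: "\<And>v. 0 < cmod v \<Longrightarrow> cmod v < \<epsilon> / 2 \<Longrightarrow> v \<notin> range b \<Longrightarrow> g v \<noteq> 0"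
    and angles: "0 \<le> p" "p \<le> s" "0 < s" "s < t" "t < pi" "p \<le> pi / 2" "\<tau> * t < pi / 2"
    and b_Arg: "\<And>k. cmod (b k) \<le> \<epsilon> \<Longrightarrow> \<bar>Arg (b k)\<bar> \<le> p"
    and c0: "0 < c0"
    and lower: "\<And>v. 0 < cmod v \<Longrightarrow> cmod v < \<epsilon> / 2 \<Longrightarrow> s \<le> \<bar>Arg v\<bar> \<Longrightarrow> v \<notin> range b \<Longrightarrow> c0 \<le> cmod (g v)"
begin

lemma F_holo: "F holomorphic_on ball 0 (\<epsilon> / 2) - {0}"
  unfolding holomorphic_on_open[OF open_Diff[OF open_ball closed_singleton]]
proof
  fix x assume "x \<in> ball (0::complex) (\<epsilon> / 2) - {0}"
  then have "F field_differentiable at x"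
    using nozero[of x] eps by (intro F_derivative(1)) auto
  then show "\<exists>f'. (F has_field_derivative f') (at x)" by (simp add: field_differentiable_def)
qed

lemma F_zero_iff: "0 < cmod v \<Longrightarrow> cmod v < \<epsilon> / 2 \<Longrightarrow> F v = 0 \<longleftrightarrow> v \<in> range b"
  unfolding F_def using nozero[of v] by simp

section \<open>The power map between the sector and the right half-plane\<close>

definition "\<gamma> = pi / (2 * t)"
definition "\<beta> = 2 * t / pi"
definition "\<sigma> = \<tau> * \<beta>"

text \<open>\<open>\<gamma>\<close> opens the half-angle \<open>t\<close> to \<open>pi / 2\<close>,
  and \<open>\<beta>\<close> is its inverse. The condition \<open>\<tau> * t < pi / 2\<close>
  amounts to \<open>\<sigma> < 1\<close>, and \<open>t < pi\<close> to
  \<open>\<beta> < 2\<close>.\<close>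

lemma params: "0 < t" "0 < \<gamma>" "0 < \<beta>" "\<beta> < 2" "\<gamma> * \<beta> = 1" "0 < \<sigma>" "\<sigma> < 1" "\<gamma> * t = pi / 2"
  "\<gamma> * s < pi / 2" "\<gamma> * p \<le> pi / 2" "\<beta> * (pi / 2) = t"
proof -
  show t: "0 < t" using angles by auto
  show "0 < \<gamma>" "0 < \<beta>" "\<beta> < 2" "\<gamma> * \<beta> = 1" "0 < \<sigma>" "\<gamma> * t = pi / 2" "\<beta> * (pi / 2) = t"
    using t angles \<tau> by (auto simp: \<gamma>_def \<beta>_def \<sigma>_def field_simps)
  show "\<sigma> < 1" using angles by (simp add: \<sigma>_def \<beta>_def field_simps)
  have "\<gamma> * s < \<gamma> * t" "\<gamma> * p \<le> \<gamma> * s" using \<open>0 < \<gamma>\<close> angles by auto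
  then show "\<gamma> * s < pi / 2" "\<gamma> * p \<le> pi / 2" using \<open>\<gamma> * t = pi / 2\<close> by linarith+
qed

text \<open>\<open>V \<zeta> = \<zeta>\<^sup>-\<^sup>\<beta>\<close> maps the right half-plane onto the sector \<open>\<bar>Arg v\<bar> < t\<close>, with inverse \<open>W v = v\<^sup>-\<^sup>\<gamma>\<close>.\<close>

definition V :: "complex \<Rightarrow> complex" where "V \<zeta> = exp (- of_real \<beta> * Ln \<zeta>)"
definition W :: "complex \<Rightarrow> complex" where "W v = exp (- of_real \<gamma> * Ln v)"

lemma Im_Ln_right: "0 < Re \<zeta> \<Longrightarrow> \<bar>Im (Ln \<zeta>)\<bar> < pi / 2"
  using Re_Ln_pos_lt[of \<zeta>] by fastforce

lemma Ln_W: assumes "v \<noteq> 0" "\<bar>Arg v\<bar> \<le> t" shows "Ln (W v) = - of_real \<gamma> * Ln v"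
proof -
  have "\<gamma> * \<bar>Arg v\<bar> \<le> \<gamma> * t" using assms params by (intro mult_left_mono) auto
  then have "\<bar>Im (- of_real \<gamma> * Ln v)\<bar> \<le> pi / 2"
    using assms params by (simp add: Arg_eq_Im_Ln abs_mult)
  then have "- pi < Im (- of_real \<gamma> * Ln v)" "Im (- of_real \<gamma> * Ln v) \<le> pi"
    using pi_gt_zero by linarith+
  then show ?thesis unfolding W_def by (rule Ln_exp)
qed

lemma V_W: "v \<noteq> 0 \<Longrightarrow> \<bar>Arg v\<bar> \<le> t \<Longrightarrow> V (W v) = v"
proof -
  assume *: "v \<noteq> 0" "\<bar>Arg v\<bar> \<le> t"
  have "- of_real \<beta> * Ln (W v) = of_real (\<gamma> * \<beta>) * Ln v" unfolding Ln_W[OF *] by simp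
  then show ?thesis using params * by (simp add: V_def)
qed

lemma Ln_V: assumes "0 < Re \<zeta>" shows "Ln (V \<zeta>) = - of_real \<beta> * Ln \<zeta>"
proof -
  have "\<beta> * \<bar>Im (Ln \<zeta>)\<bar> \<le> \<beta> * (pi / 2)"
    using Im_Ln_right[OF assms] params(3) by (intro mult_left_mono) auto
  also have "\<dots> = t" by (rule params(11))
  finally have "\<beta> * \<bar>Im (Ln \<zeta>)\<bar> \<le> t" .
  then have "\<bar>Im (- of_real \<beta> * Ln \<zeta>)\<bar> \<le> t" using params(3) by (simp add: abs_mult)
  then have "- pi < Im (- of_real \<beta> * Ln \<zeta>)" "Im (- of_real \<beta> * Ln \<zeta>) \<le> pi"
    using angles(5) by linarith+
  then show ?thesis unfolding V_def by (rule Ln_exp)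
qed

lemma W_V: assumes "0 < Re \<zeta>" shows "W (V \<zeta>) = \<zeta>"
proof -
  have "- of_real \<gamma> * Ln (V \<zeta>) = of_real (\<gamma> * \<beta>) * Ln \<zeta>" unfolding Ln_V[OF assms] by simp
  moreover have "\<zeta> \<noteq> 0" using assms by auto
  ultimately show ?thesis using params by (simp add: W_def)
qed

lemma norm_V: "\<zeta> \<noteq> 0 \<Longrightarrow> cmod (V \<zeta>) = cmod \<zeta> powr (- \<beta>)"
  by (simp add: V_def powr_def)

lemma norm_W: "v \<noteq> 0 \<Longrightarrow> cmod (W v) = cmod v powr (- \<gamma>)"
  by (simp add: W_def powr_def)

lemma b_Arg_t: "cmod (b k) \<le> \<epsilon> \<Longrightarrow> \<bar>Arg (b k)\<bar> \<le> t"
  using b_Arg[of k] angles by linarith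

text \<open>\<open>N\<close> is a set, so each pole counts once, however often it is repeated in the sequence: the
  poles of \<open>g\<close> are simple.\<close>

definition "N = W ` b ` {k. cmod (b k) \<le> \<epsilon>}"

lemma N_norm: "q \<in> N \<Longrightarrow> 1 \<le> cmod q"
proof -
  assume "q \<in> N"
  then obtain k where k: "q = W (b k)" "cmod (b k) \<le> \<epsilon>" by (auto simp: N_def)
  have "cmod (b k) powr \<gamma> \<le> 1" using k eps params by (intro powr_le1) auto
  then show ?thesis using b_nz[of k] k by (simp add: norm_W powr_minus_divide)
qed

lemma finite_N: "finite {q \<in> N. cmod q \<le> R}"
proof (cases "R > 0")
  case True
  have "{q \<in> N. cmod q \<le> R} \<subseteq> W ` b ` {k. R powr (- \<beta>) \<le> cmod (b k) \<and> cmod (b k) \<le> \<epsilon>}"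
  proof
    fix q assume "q \<in> {q \<in> N. cmod q \<le> R}"
    then obtain k where k: "q = W (b k)" "cmod (b k) \<le> \<epsilon>" "cmod q \<le> R" by (auto simp: N_def)
    have "cmod (b k) powr (- \<gamma>) \<le> R" using k b_nz[of k] by (simp add: norm_W)
    then have "R powr (- \<beta>) \<le> (cmod (b k) powr (- \<gamma>)) powr (- \<beta>)"
      using b_nz[of k] params True by (intro powr_mono2') auto
    also have "\<dots> = cmod (b k)" using params b_nz[of k] by (simp add: powr_powr)
    finally show "q \<in> W ` b ` {k. R powr (- \<beta>) \<le> cmod (b k) \<and> cmod (b k) \<le> \<epsilon>}" using k by auto
  qed
  moreover have "0 < R powr (- \<beta>)" using True by simp
  ultimately show ?thesis using finite_annulus by (meson finite_imageI finite_subset)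
next
  case False
  then have E: "{q \<in> N. cmod q \<le> R} = {}" using N_norm by force
  show ?thesis unfolding E by simp
qed

section \<open>Products over the transformed poles\<close>

definition "M = (\<Sum>\<^sub>\<infinity>k\<in>{k. cmod (b k) \<le> \<epsilon>}. cmod (b k) powr \<tau>)"

lemma M_nonneg: "0 \<le> M"
  unfolding M_def by (intro infsum_nonneg) auto

text \<open>\<open>|W (b k)| powr (- \<sigma>) = |b k| powr \<tau>\<close>. The set \<open>S\<close>
  is first lifted to a set of indices on which \<open>W \<circ> b\<close> is injective, since a pole
  may occur at several indices.\<close>

lemma sum_N: assumes "S \<subseteq> N" "finite S" shows "(\<Sum>q\<in>S. (1 / cmod q) powr \<sigma>) \<le> M"
proof -
  have "S \<subseteq> (W \<circ> b) ` {k. cmod (b k) \<le> \<epsilon>}" using assms by (auto simp: N_def)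
  then obtain K where K: "K \<subseteq> {k. cmod (b k) \<le> \<epsilon>}" "inj_on (W \<circ> b) K" "S = (W \<circ> b) ` K"
    unfolding subset_image_inj by blast
  have fK: "finite K" using finite_image_iff[OF K(2)] K(3) assms(2) by simp
  have "(\<Sum>q\<in>S. (1 / cmod q) powr \<sigma>) = (\<Sum>k\<in>K. (1 / cmod (W (b k))) powr \<sigma>)"
    unfolding K(3) sum.reindex[OF K(2)] by (simp add: o_def)
  also have "\<dots> = (\<Sum>k\<in>K. cmod (b k) powr \<tau>)"
  proof (rule sum.cong[OF refl])
    fix k
    have "(1 / cmod (W (b k))) powr \<sigma> = (cmod (b k) powr \<gamma>) powr \<sigma>"
      using b_nz[of k] by (simp add: norm_W powr_minus_divide)
    also have "\<dots> = cmod (b k) powr (\<tau> * (\<gamma> * \<beta>))" by (simp add: powr_powr \<sigma>_def mult_ac)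
    finally show "(1 / cmod (W (b k))) powr \<sigma> = cmod (b k) powr \<tau>" using params by simp
  qed
  also have "\<dots> \<le> M" unfolding M_def using K fK b_sum by (intro finite_sum_le_infsum) auto
  finally show ?thesis .
qed

definition "D = (1 + 1 / \<sigma>) * M"

text \<open>The constant \<open>D\<close> does not depend on \<open>S\<close>, so the bound serves
  every truncation and also products from which one factor has been removed.\<close>

lemma prod_N_le:
  assumes "S \<subseteq> N" "finite S"
  shows "cmod (\<Prod>q\<in>S. 1 - x / q) \<le> exp (D * cmod x powr \<sigma>)"
proof -
  have "cmod (\<Prod>q\<in>S. 1 - x / q) \<le> (\<Prod>q\<in>S. 1 + cmod x / cmod q)"
    unfolding prod_norm[symmetric]
    by (intro prod_mono conjI norm_ge_zero order_trans[OF norm_triangle_ineq4]) (simp add: norm_divide)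
  also have "\<dots> \<le> exp ((1 + 1 / \<sigma>) * (\<Sum>q\<in>S. (cmod x / cmod q) powr \<sigma>))"
    using params by (intro prod_1_plus_le_exp_powr) auto
  also have "(\<Sum>q\<in>S. (cmod x / cmod q) powr \<sigma>) = cmod x powr \<sigma> * (\<Sum>q\<in>S. (1 / cmod q) powr \<sigma>)"
    by (simp add: sum_distrib_left powr_mult[symmetric])
  also have "exp ((1 + 1 / \<sigma>) * (cmod x powr \<sigma> * (\<Sum>q\<in>S. (1 / cmod q) powr \<sigma>))) \<le> exp ((1 + 1 / \<sigma>) * (cmod x powr \<sigma> * M))"
    using sum_N[OF assms] params by (simp add: mult_left_mono)
  finally show ?thesis by (simp add: D_def mult_ac)
qed

text \<open>With \<open>y = |x| / |q| \<le> 1 / 2\<close>, each factor is at least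
  \<open>1 - y \<ge> exp (- 2 * y)\<close>, and \<open>y \<le> y powr \<sigma>\<close> brings in the
  sum bounded by \<open>M\<close>.\<close>

lemma prod_N_ge:
  assumes "S \<subseteq> N" "finite S" "\<And>q. q \<in> S \<Longrightarrow> 2 * cmod x \<le> cmod q"
  shows "exp (- 2 * M * cmod x powr \<sigma>) \<le> cmod (\<Prod>q\<in>S. 1 - x / q)"
proof -
  have "- 2 * M * cmod x powr \<sigma> \<le> - 2 * ((\<Sum>q\<in>S. (1 / cmod q) powr \<sigma>) * cmod x powr \<sigma>)"
    using mult_right_mono[OF sum_N[OF assms(1,2)], of "cmod x powr \<sigma>"] by simp
  also have "(\<Sum>q\<in>S. (1 / cmod q) powr \<sigma>) * cmod x powr \<sigma> = (\<Sum>q\<in>S. (cmod x / cmod q) powr \<sigma>)"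
    by (simp add: sum_distrib_right powr_mult[symmetric])
  finally have "exp (- 2 * M * cmod x powr \<sigma>) \<le> exp (\<Sum>q\<in>S. - 2 * (cmod x / cmod q) powr \<sigma>)"
    by (simp add: sum_distrib_left)
  also have "\<dots> = (\<Prod>q\<in>S. exp (- 2 * (cmod x / cmod q) powr \<sigma>))" using assms by (simp add: exp_sum)
  also have "\<dots> \<le> (\<Prod>q\<in>S. cmod (1 - x / q))"
  proof (intro prod_mono conjI)
    fix q assume q: "q \<in> S"
    define y where "y = cmod x / cmod q"
    have q0: "cmod q > 0" using N_norm assms q by force
    have y: "0 \<le> y" "y \<le> 1 / 2" using assms(3)[OF q] q0 by (auto simp: y_def field_simps)
    have "y = y powr 1" using y by simp
    also have "\<dots> \<le> y powr \<sigma>" using y params by (intro powr_mono') auto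
    finally have "exp (- 2 * y powr \<sigma>) \<le> exp (- 2 * y)" by simp
    also have "\<dots> \<le> 1 - y"
    proof -
      have "- 2 * y \<le> ln (1 - y)"
        using ln_one_minus_pos_lower_bound[of y] y mult_left_mono[OF y(2) y(1)] by (simp add: power2_eq_square)
      then have "exp (- 2 * y) \<le> exp (ln (1 - y))" by (simp only: exp_le_cancel_iff)
      then show ?thesis using y by simp
    qed
    also have "\<dots> \<le> cmod (1 - x / q)"
      using norm_triangle_ineq2[of 1 "x / q"] by (simp add: y_def norm_divide)
    finally show "exp (- 2 * (cmod x / cmod q) powr \<sigma>) \<le> cmod (1 - x / q)" by (simp add: y_def)
  qed auto
  finally show ?thesis by (simp add: prod_norm)
qed

text \<open>With \<open>u = Ln (b k) - Ln (V \<zeta>)\<close>, the two alternatives are \<open>\<bar>Re u\<bar> > 1\<close>, when \<open>b k\<close> and \<open>V \<zeta>\<close>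
  have quite different moduli, and \<open>\<bar>Re u\<bar> \<le> 1\<close>, when \<open>b k - V \<zeta>\<close> is compared with \<open>u\<close> and so with
  the factor \<open>1 - \<zeta> / W (b k)\<close>.\<close>

lemma near_term_bound:
  obtains K where "0 < K" and
    "\<And>k \<zeta>. cmod (b k) \<le> \<epsilon> \<Longrightarrow> 0 < Re \<zeta> \<Longrightarrow> 1 \<le> cmod \<zeta> \<Longrightarrow>
       1 \<le> K * cmod \<zeta> ^ 3 * cmod (b k - V \<zeta>) \<or>
       cmod (W (b k)) \<le> exp (1 / \<beta>) * cmod \<zeta> \<and> cmod (1 - \<zeta> / W (b k)) \<le> K * cmod \<zeta> ^ 3 * cmod (b k - V \<zeta>)"
proof -
  have "0 < p + t" "p + t < 2 * pi" using angles params by linarith+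
  then obtain c where c: "c > 0"
    "\<And>u. \<bar>Re u\<bar> \<le> 1 \<Longrightarrow> \<bar>Im u\<bar> \<le> p + t \<Longrightarrow> c * cmod u \<le> cmod (exp u - 1)"
    using norm_exp_minus_1_ge[of "p + t"] by blast
  define K where "K = max 4 (1 / (c * \<beta>))"
  have K: "K > 0" "K \<ge> 4" "K \<ge> 1 / (c * \<beta>)" by (auto simp: K_def)
  show thesis
  proof (rule that[OF K(1)])
    fix k \<zeta> assume k: "cmod (b k) \<le> \<epsilon>" and \<zeta>: "0 < Re \<zeta>" "1 \<le> cmod \<zeta>"
    define v where "v = V \<zeta>"
    define q where "q = W (b k)"
    have qN: "q \<in> N" using k by (auto simp: q_def N_def)
    have q1: "1 \<le> cmod q" by (rule N_norm[OF qN])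
    have z0: "\<zeta> \<noteq> 0" "v \<noteq> 0" "q \<noteq> 0" using \<zeta> by (auto simp: v_def V_def q_def W_def)
    have Lq: "Ln (b k) = - of_real \<beta> * Ln q"
    proof -
      have "- of_real \<beta> * Ln q = of_real (\<gamma> * \<beta>) * Ln (b k)"
        unfolding q_def Ln_W[OF b_nz b_Arg_t[OF k]] by simp
      then show ?thesis using params by simp
    qed
    \<comment> \<open>Up to the factor \<open>\<beta>\<close>, \<open>d\<close> and \<open>u\<close>
      are the same logarithmic difference: \<open>exp d = \<zeta> / q\<close> governs the factor of
      the product, \<open>exp u = b k / v\<close> the distance to the pole.\<close>
    define d where "d = Ln \<zeta> - Ln q"
    define u where "u = of_real \<beta> * d"
    have u: "u = Ln (b k) - Ln v" unfolding u_def d_def Lq v_def Ln_V[OF \<zeta>(1)] by (simp add: algebra_simps)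
    have eu: "exp u = b k / v" unfolding u using z0 b_nz by (simp add: exp_diff)
    have ed: "exp d = \<zeta> / q" unfolding d_def using z0 by (simp add: exp_diff)
    have vb: "cmod (b k - v) = cmod v * cmod (exp u - 1)"
      unfolding eu norm_mult[symmetric] using z0 by (simp add: algebra_simps)
    have Imu: "\<bar>Im u\<bar> \<le> p + t"
    proof -
      have "\<beta> * \<bar>Im (Ln \<zeta>)\<bar> \<le> \<beta> * (pi / 2)" using Im_Ln_right[OF \<zeta>(1)] params by (intro mult_left_mono) auto
      then have "\<bar>Im (Ln v)\<bar> \<le> t" unfolding v_def Ln_V[OF \<zeta>(1)] params(11) using params(3) by (simp add: abs_mult)
      moreover have "\<bar>Im (Ln (b k))\<bar> \<le> p" using b_Arg[OF k] b_nz by (simp add: Arg_eq_Im_Ln)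
      ultimately show ?thesis unfolding u by simp
    qed
    \<comment> \<open>\<open>\<beta> < 2\<close> gives
      \<open>|v| \<ge> |\<zeta>| powr (- 2)\<close>; this accounts for two of the three powers of
      \<open>|\<zeta>|\<close>.\<close>
    have vl: "1 \<le> cmod \<zeta> ^ 2 * cmod v"
    proof -
      have "cmod v = cmod \<zeta> powr - \<beta>" unfolding v_def using z0 by (simp add: norm_V)
      also have "\<dots> \<ge> cmod \<zeta> powr (- 2)" using \<zeta> params by (intro powr_mono) auto
      finally have "cmod \<zeta> powr 2 * cmod \<zeta> powr (- 2) \<le> cmod \<zeta> powr 2 * cmod v" by (intro mult_left_mono) auto
      moreover have "cmod \<zeta> powr 2 * cmod \<zeta> powr (- 2) = 1" unfolding powr_add[symmetric] using z0 by simp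
      moreover have "cmod \<zeta> powr 2 = cmod \<zeta> ^ 2" using z0 by (simp add: powr_numeral)
      ultimately show ?thesis by simp
    qed
    have z23: "cmod \<zeta> ^ 2 \<le> cmod \<zeta> ^ 3" using \<zeta> by (intro power_increasing) auto
    consider "\<bar>Re u\<bar> \<le> 1" | "Re u > 1" | "Re u < - 1" by linarith
    then show "1 \<le> K * cmod \<zeta> ^ 3 * cmod (b k - V \<zeta>) \<or>
       cmod (W (b k)) \<le> exp (1 / \<beta>) * cmod \<zeta> \<and> cmod (1 - \<zeta> / W (b k)) \<le> K * cmod \<zeta> ^ 3 * cmod (b k - V \<zeta>)"
    proof cases
      case 1
      have "Re d \<ge> - (1 / \<beta>)"
      proof -
        have "\<beta> * Re d \<ge> - 1" using 1 by (simp add: u_def)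
        then show ?thesis using params by (simp add: field_simps)
      qed
      then have "exp (- (1 / \<beta>)) \<le> exp (Re d)" by simp
      also have "\<dots> = cmod \<zeta> / cmod q" unfolding norm_exp_eq_Re[symmetric] ed by (simp add: norm_divide)
      finally have "exp (- (1 / \<beta>)) * cmod q \<le> cmod \<zeta>" using q1 by (subst (asm) pos_le_divide_eq) auto
      then have "exp (1 / \<beta>) * (exp (- (1 / \<beta>)) * cmod q) \<le> exp (1 / \<beta>) * cmod \<zeta>"
        by (intro mult_left_mono) auto
      then have "cmod q \<le> exp (1 / \<beta>) * cmod \<zeta>"
        unfolding mult.assoc[symmetric] exp_add[symmetric] by simp
      moreover have "cmod (1 - \<zeta> / q) \<le> K * cmod \<zeta> ^ 3 * cmod (b k - v)"
      proof -
        \<comment> \<open>Mean value inequality on a half-plane containing 0 and \<open>d\<close>,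
          where the derivative is at most \<open>max 1 |\<zeta> / q| \<le> |\<zeta>|\<close> since
          \<open>|\<zeta>|\<close> and \<open>|q|\<close> are at least 1. This costs the third
          power.\<close>
        have "cmod (exp d - 1) \<le> cmod \<zeta> * cmod d"
        proof -
          have "cmod (exp d - exp 0) \<le> cmod \<zeta> * cmod (d - 0)"
          proof (rule field_differentiable_bound[where S = "{w. Re w \<le> max 0 (Re d)}" and f = exp and f' = exp])
            show "convex {w. Re w \<le> max 0 (Re d)}" by (rule convex_halfspace_Re_le)
            fix w assume "w \<in> {w. Re w \<le> max 0 (Re d)}"
            then have "exp (Re w) \<le> exp (max 0 (Re d))" by simp
            also have "\<dots> = max 1 (exp (Re d))" by (simp add: max_def)
            also have "exp (Re d) = cmod \<zeta> / cmod q" unfolding norm_exp_eq_Re[symmetric] ed by (simp add: norm_divide)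
            also have "max 1 (cmod \<zeta> / cmod q) \<le> cmod \<zeta>"
              using \<zeta> q1 mult_left_mono[OF q1, of "cmod \<zeta>"] by (simp add: divide_simps)
            finally show "cmod (exp w) \<le> cmod \<zeta>" by simp
            show "(exp has_field_derivative exp w) (at w within {w. Re w \<le> max 0 (Re d)})"
              by (intro DERIV_exp has_field_derivative_at_within)
          qed auto
          then show ?thesis by simp
        qed
        then have "cmod (1 - \<zeta> / q) \<le> cmod \<zeta> * cmod d" unfolding ed by (simp add: norm_minus_commute)
        also have "cmod d = cmod u / \<beta>" using params by (simp add: u_def norm_mult)
        also have "cmod \<zeta> * (cmod u / \<beta>) = cmod \<zeta> * (1 / (c * \<beta>)) * (c * cmod u)" using c by simp
        also have "\<dots> \<le> cmod \<zeta> * K * cmod (exp u - 1)"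
          using c(2)[OF 1 Imu] K c(1) params(3) by (intro mult_mono) auto
        also have "\<dots> \<le> (cmod \<zeta> * K * cmod (exp u - 1)) * (cmod \<zeta> ^ 2 * cmod v)"
          using mult_left_mono[OF vl, of "cmod \<zeta> * K * cmod (exp u - 1)"] K by simp
        also have "\<dots> = K * cmod \<zeta> ^ 3 * cmod (b k - v)" unfolding vb by (simp add: power3_eq_cube power2_eq_square)
        finally show ?thesis .
      qed
      ultimately show ?thesis unfolding q_def v_def by blast
    next
      case 2
      have "1 + 1 \<le> exp (1::real)" by (rule exp_ge_add_one_self)
      also have "\<dots> \<le> cmod (exp u)" using 2 by simp
      finally have "1 \<le> cmod (exp u - 1)" using norm_triangle_ineq2[of "exp u" 1] by simp
      then have "1 * 1 * 1 \<le> (K * cmod (exp u - 1)) * (cmod \<zeta> ^ 2 * cmod v)"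
        using vl K by (intro mult_mono) auto
      also have "\<dots> = K * cmod (b k - v) * cmod \<zeta> ^ 2" unfolding vb by simp
      also have "\<dots> \<le> K * cmod (b k - v) * cmod \<zeta> ^ 3" using K z23 by (intro mult_left_mono) auto
      finally show ?thesis unfolding v_def by (simp add: mult_ac)
    next
      case 3
      have "1 + 1 \<le> exp (1::real)" by (rule exp_ge_add_one_self)
      then have "exp (- 1) \<le> (1 / 2 :: real)" by (simp add: exp_minus field_simps)
      moreover have "cmod (exp u) \<le> exp (- 1)" using 3 by simp
      ultimately have "1 / 2 \<le> cmod (exp u - 1)" using norm_triangle_ineq2[of 1 "exp u"] norm_one[where 'a = complex]
        unfolding norm_minus_commute[of 1] by linarith
      then have "4 * (1 / 2) * 1 \<le> (K * cmod (exp u - 1)) * (cmod \<zeta> ^ 2 * cmod v)"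
        using vl K by (intro mult_mono) auto
      also have "\<dots> = K * cmod (b k - v) * cmod \<zeta> ^ 2" unfolding vb by simp
      also have "\<dots> \<le> K * cmod (b k - v) * cmod \<zeta> ^ 3" using K z23 by (intro mult_left_mono) auto
      finally show ?thesis unfolding v_def by (simp add: mult_ac)
    qed
  qed
qed

text \<open>The constant makes \<open>Z R\<close> contain every \<open>q\<close> falling under the second alternative above for
  some \<open>\<zeta>\<close> with \<open>\<bar>\<zeta>\<bar> \<le> 3 R\<close>.\<close>

definition \<kappa> :: real where "\<kappa> = 3 * exp (1 / \<beta>)"
definition Z :: "real \<Rightarrow> complex set" where "Z R = {q \<in> N. cmod q \<le> \<kappa> * R}"
definition P :: "real \<Rightarrow> complex \<Rightarrow> complex" where "P R x = (\<Prod>q\<in>Z R. 1 - x / q)"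

lemma Z: "Z R \<subseteq> N" "finite (Z R)"
  unfolding Z_def using finite_N by auto

lemma \<kappa>: "3 \<le> \<kappa>"
  unfolding \<kappa>_def using params by simp

lemma P_bound: "cmod (P R x) \<le> exp (D * cmod x powr \<sigma>)"
  unfolding P_def by (rule prod_N_le[OF Z])

text \<open>The product is bounded term by term: either \<open>b k\<close> is not too close to
  \<open>V \<zeta>\<close>, or the factor of \<open>P R\<close> belonging to \<open>b k\<close>
  compensates the small denominator and \<open>prod_N_le\<close> bounds the other factors. The
  estimates are then summed against \<open>a k\<close>.\<close>

lemma P_g_bound:
  obtains K where "0 < K" and
    "\<And>R \<zeta>. 0 < Re \<zeta> \<Longrightarrow> 1 \<le> cmod \<zeta> \<Longrightarrow> cmod \<zeta> \<le> 3 * R \<Longrightarrow> cmod (V \<zeta>) < \<epsilon> / 2 \<Longrightarrow> V \<zeta> \<notin> range b \<Longrightarrow>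
       cmod (P R \<zeta> * g (V \<zeta>)) \<le> K * cmod \<zeta> ^ 3 * exp (D * cmod \<zeta> powr \<sigma>)"
proof -
  obtain K0 where K0: "0 < K0" and
    nb: "\<And>k \<zeta>. cmod (b k) \<le> \<epsilon> \<Longrightarrow> 0 < Re \<zeta> \<Longrightarrow> 1 \<le> cmod \<zeta> \<Longrightarrow>
       1 \<le> K0 * cmod \<zeta> ^ 3 * cmod (b k - V \<zeta>) \<or>
       cmod (W (b k)) \<le> exp (1 / \<beta>) * cmod \<zeta> \<and> cmod (1 - \<zeta> / W (b k)) \<le> K0 * cmod \<zeta> ^ 3 * cmod (b k - V \<zeta>)"
    using near_term_bound by blast
  define K1 where "K1 = max K0 (2 / \<epsilon>)"
  have K1: "K1 > 0" "K0 \<le> K1" "2 / \<epsilon> \<le> K1" using K0 by (auto simp: K1_def)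
  have A0: "suminf a > 0" using a_pos a_sum by (intro suminf_pos) auto
  show thesis
  proof (rule that[of "K1 * suminf a"])
    fix R \<zeta> assume \<zeta>: "0 < Re \<zeta>" "1 \<le> cmod \<zeta>" "cmod \<zeta> \<le> 3 * R" "cmod (V \<zeta>) < \<epsilon> / 2" "V \<zeta> \<notin> range b"
    define E where "E = exp (D * cmod \<zeta> powr \<sigma>)"
    have E: "E > 0" by (simp add: E_def)
    have z3: "cmod \<zeta> ^ 3 \<ge> 1" using \<zeta> by simp
    have bnd: "cmod (P R \<zeta>) \<le> K1 * cmod \<zeta> ^ 3 * E * cmod (b k - V \<zeta>)" for k
    proof -
      have triv: "cmod (P R \<zeta>) \<le> K1 * cmod \<zeta> ^ 3 * E * cmod (b k - V \<zeta>)"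
        if "1 \<le> K1 * cmod \<zeta> ^ 3 * cmod (b k - V \<zeta>)"
      proof -
        have "cmod (P R \<zeta>) \<le> 1 * E" using P_bound[of R \<zeta>] by (simp add: E_def)
        also have "\<dots> \<le> (K1 * cmod \<zeta> ^ 3 * cmod (b k - V \<zeta>)) * E"
          using that E by (intro mult_right_mono) auto
        finally show ?thesis by (simp add: mult_ac)
      qed
      have le: "K0 * cmod \<zeta> ^ 3 * cmod (b k - V \<zeta>) \<le> K1 * cmod \<zeta> ^ 3 * cmod (b k - V \<zeta>)"
        using K1 by (intro mult_right_mono) auto
      show ?thesis
      proof (cases "cmod (b k) \<le> \<epsilon>")
        case False
        have "\<epsilon> / 2 \<le> cmod (b k - V \<zeta>)" using False \<zeta>(4) norm_triangle_ineq2[of "b k" "V \<zeta>"] by linarith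
        then have "(2 / \<epsilon>) * 1 * (\<epsilon> / 2) \<le> K1 * cmod \<zeta> ^ 3 * cmod (b k - V \<zeta>)"
          using K1 z3 eps by (intro mult_mono) auto
        then show ?thesis using eps by (intro triv) simp
      next
        case True
        from nb[OF True \<zeta>(1,2)] show ?thesis
        proof (elim disjE conjE)
          assume "1 \<le> K0 * cmod \<zeta> ^ 3 * cmod (b k - V \<zeta>)"
          then show ?thesis using le by (intro triv) linarith
        next
          assume q1: "cmod (W (b k)) \<le> exp (1 / \<beta>) * cmod \<zeta>"
            and q2: "cmod (1 - \<zeta> / W (b k)) \<le> K0 * cmod \<zeta> ^ 3 * cmod (b k - V \<zeta>)"
          have "exp (1 / \<beta>) * cmod \<zeta> \<le> exp (1 / \<beta>) * (3 * R)" using \<zeta> by (intro mult_left_mono) auto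
          then have "cmod (W (b k)) \<le> exp (1 / \<beta>) * (3 * R)" using q1 by linarith
          then have "cmod (W (b k)) \<le> \<kappa> * R" by (simp only: \<kappa>_def mult_ac)
          then have qZ: "W (b k) \<in> Z R" using True by (auto simp: Z_def N_def)
          have "cmod (P R \<zeta>) = cmod (1 - \<zeta> / W (b k)) * cmod (\<Prod>q\<in>Z R - {W (b k)}. 1 - \<zeta> / q)"
            unfolding P_def prod.remove[OF Z(2) qZ] norm_mult ..
          also have "\<dots> \<le> (K1 * cmod \<zeta> ^ 3 * cmod (b k - V \<zeta>)) * E"
            unfolding E_def using q2 le Z K1 by (intro mult_mono prod_N_le) auto
          finally show ?thesis by (simp add: mult_ac)
        qed
      qed
    qed
    have tm: "cmod (P R \<zeta> * (of_real (a k) / (b k - V \<zeta>))) \<le> a k * (K1 * cmod \<zeta> ^ 3 * E)" for k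
    proof -
      have "b k \<noteq> V \<zeta>" using \<zeta>(5) by (metis rangeI)
      then have "cmod (b k - V \<zeta>) > 0" by simp
      then have "cmod (P R \<zeta>) / cmod (b k - V \<zeta>) \<le> K1 * cmod \<zeta> ^ 3 * E"
        using bnd[of k] by (simp add: field_simps)
      then have "a k * (cmod (P R \<zeta>) / cmod (b k - V \<zeta>)) \<le> a k * (K1 * cmod \<zeta> ^ 3 * E)"
        using a_pos[of k] by (intro mult_left_mono) auto
      then show ?thesis using a_pos[of k] by (simp add: norm_mult norm_divide mult_ac)
    qed
    have "cmod (P R \<zeta> * g (V \<zeta>)) = cmod (\<Sum>k. P R \<zeta> * (of_real (a k) / (b k - V \<zeta>)))"
    proof (cases "P R \<zeta> = 0")
      case False
      have "summable (\<lambda>k. P R \<zeta> * (of_real (a k) / (b k - V \<zeta>)))"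
        using tm by (intro summable_comparison_test'[OF summable_mult2[OF a_sum]]) auto
      then have "summable (\<lambda>k. of_real (a k) / (b k - V \<zeta>))" using False by (metis summable_mult_D)
      then show ?thesis unfolding g_def by (simp only: suminf_mult)
    qed simp
    also have "\<dots> \<le> (\<Sum>k. a k * (K1 * cmod \<zeta> ^ 3 * E))"
      using tm by (intro norm_suminf_le summable_mult2[OF a_sum]) auto
    also have "\<dots> = suminf a * (K1 * cmod \<zeta> ^ 3 * E)" by (simp add: suminf_mult2[OF a_sum])
    finally show "cmod (P R \<zeta> * g (V \<zeta>)) \<le> K1 * suminf a * cmod \<zeta> ^ 3 * exp (D * cmod \<zeta> powr \<sigma>)"
      by (simp add: E_def mult_ac)
  qed (use K1 A0 in simp)
qed

section \<open>Tangent discs and the zero-free quotient\<close>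

definition "R0 = (\<epsilon> / 2) powr (- \<gamma>)"

lemma R0: "1 \<le> R0"
proof -
  have "(\<epsilon> / 2) powr \<gamma> \<le> 1" using eps params by (intro powr_le1) auto
  then show ?thesis using eps by (simp add: R0_def powr_minus_divide)
qed

lemma V_nz: "0 < cmod (V \<zeta>)"
  by (simp add: V_def)

lemma V_small: assumes "R0 < cmod \<zeta>" shows "cmod (V \<zeta>) < \<epsilon> / 2"
proof -
  have "cmod (V \<zeta>) = cmod \<zeta> powr (- \<beta>)" using assms R0 by (intro norm_V) auto
  also have "\<dots> < R0 powr (- \<beta>)" using assms R0 params by (intro powr_less_mono2_neg) auto
  also have "\<dots> = (\<epsilon> / 2) powr (\<gamma> * \<beta>)" using eps by (simp add: R0_def powr_powr)
  also have "\<dots> = \<epsilon> / 2" using eps params by simp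
  finally show ?thesis .
qed

lemma V_pole_iff: assumes "0 < Re \<zeta>" "R0 < cmod \<zeta>" shows "V \<zeta> \<in> range b \<longleftrightarrow> \<zeta> \<in> N"
proof
  assume "V \<zeta> \<in> range b"
  then obtain k where k: "V \<zeta> = b k" by auto
  then have "cmod (b k) \<le> \<epsilon>" using V_small[OF assms(2)] eps by auto
  moreover have "\<zeta> = W (b k)" using W_V[OF assms(1)] k by simp
  ultimately show "\<zeta> \<in> N" by (auto simp: N_def)
next
  assume "\<zeta> \<in> N"
  then obtain k where k: "\<zeta> = W (b k)" "cmod (b k) \<le> \<epsilon>" by (auto simp: N_def)
  then show "V \<zeta> \<in> range b" using V_W[OF b_nz b_Arg_t[OF k(2)]] by auto
qed

definition "D' = D / cos (\<sigma> * (pi / 2))"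

text \<open>Turns a bound of order \<open>\<sigma>\<close> into the modulus of a zero-free
  holomorphic function. In the half-plane
  \<open>cos (\<sigma> * Im (Ln x)) \<ge> cos (\<sigma> * (pi / 2))\<close>, which is positive
  because \<open>\<sigma> < 1\<close>; \<open>D'\<close> makes up for this loss.\<close>

lemma majorant_ge:
  assumes "0 < Re x"
  shows "exp (D * cmod x powr \<sigma>) \<le> cmod (exp (of_real D' * exp (of_real \<sigma> * Ln x)))"
proof -
  have x: "x \<noteq> 0" using assms by auto
  have D0: "0 \<le> D" using M_nonneg params by (simp add: D_def)
  have s: "0 < \<sigma> * (pi / 2)" "\<sigma> * (pi / 2) < pi / 2" using params by auto
  have c: "0 < cos (\<sigma> * (pi / 2))" using s by (intro cos_gt_zero) auto
  have "\<sigma> * \<bar>Im (Ln x)\<bar> \<le> \<sigma> * (pi / 2)" using Im_Ln_right[OF assms] params by (intro mult_left_mono) auto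
  then have "cos (\<sigma> * (pi / 2)) \<le> cos (\<sigma> * \<bar>Im (Ln x)\<bar>)"
    using s params(6) pi_gt_zero by (intro cos_monotone_0_pi_le) (simp, assumption, linarith)
  also have "\<dots> = cos (\<sigma> * Im (Ln x))" by (cases "Im (Ln x) \<ge> 0") auto
  finally have *: "cos (\<sigma> * (pi / 2)) \<le> cos (\<sigma> * Im (Ln x))" .
  have "D * cmod x powr \<sigma> = D' * cmod x powr \<sigma> * cos (\<sigma> * (pi / 2))" using c by (simp add: D'_def)
  also have "\<dots> \<le> D' * cmod x powr \<sigma> * cos (\<sigma> * Im (Ln x))"
    using * c D0 by (intro mult_left_mono) (auto simp: D'_def)
  also have "\<dots> = Re (of_real D' * exp (of_real \<sigma> * Ln x))"
    using x by (simp add: Re_exp powr_def)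
  finally show ?thesis by simp
qed

text \<open>The disc touches the line \<open>Re = R0\<close> at \<open>R0\<close>, and its farthest
  distance from 0 is \<open>R0 + 2 * R \<le> 3 * R\<close>, the source of the 3 in
  \<open>\<kappa>\<close>.\<close>

lemma disc_subset:
  assumes "R0 \<le> R" "x \<in> ball (of_real (R0 + R)) R"
  shows "R0 < Re x" "cmod x \<le> 3 * R" "R0 < cmod x" "0 < Re x" "1 \<le> cmod x"
proof -
  have d: "cmod (of_real (R0 + R) - x) < R" using assms by (simp add: dist_norm)
  show *: "R0 < Re x" using abs_Re_le_cmod[of "of_real (R0 + R) - x"] d by auto
  show "R0 < cmod x" using * complex_Re_le_cmod[of x] by linarith
  then show "1 \<le> cmod x" using R0 by simp
  show "0 < Re x" using * R0 by simp
  have "cmod x \<le> cmod (of_real (R0 + R) :: complex) + cmod (of_real (R0 + R) - x)"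
    by (metis norm_triangle_sub norm_minus_commute)
  also have "cmod (of_real (R0 + R) :: complex) = R0 + R" using R0 assms by (simp only: norm_of_real)
  finally show "cmod x \<le> 3 * R" using d assms(1) by linarith
qed

lemma V_holomorphic: "V holomorphic_on {\<zeta>. 0 < Re \<zeta>}"
  unfolding V_def by (intro holomorphic_intros) (auto simp: complex_nonpos_Reals_iff)

lemma V_deriv: "0 < Re \<zeta> \<Longrightarrow> (V has_field_derivative - of_real \<beta> / \<zeta> * V \<zeta>) (at \<zeta>)"
  unfolding V_def by (auto intro!: derivative_eq_intros simp: complex_nonpos_Reals_iff divide_inverse)

text \<open>A zero-free holomorphic majorant of \<open>P R \<cdot> (g \<circ> V)\<close>, uniform in \<open>R\<close>.\<close>

definition T :: "real \<Rightarrow> complex \<Rightarrow> complex" where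
  "T K x = of_real (2 * K + 1) * x ^ 3 * exp (of_real D' * exp (of_real \<sigma> * Ln x))"

text \<open>The coefficient \<open>2 * K + 1\<close> serves twice: being at least
  \<open>2 * K\<close>, it puts the quotient's modulus at or below 1/2; being at least 1, it lets
  \<open>T K\<close> dominate \<open>P R\<close> as well.\<close>

lemma T_ge:
  assumes "0 < Re x" "0 \<le> K"
  shows "(2 * K + 1) * (cmod x ^ 3 * exp (D * cmod x powr \<sigma>)) \<le> cmod (T K x)"
proof -
  have "(2 * K + 1) * (cmod x ^ 3 * exp (D * cmod x powr \<sigma>)) \<le> (2 * K + 1) * (cmod x ^ 3 * cmod (exp (of_real D' * exp (of_real \<sigma> * Ln x))))"
    using majorant_ge[OF assms(1)] assms(2) by (intro mult_left_mono) auto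
  also have "\<dots> = cmod (T K x)" using assms by (simp only: T_def norm_mult norm_power norm_of_real mult.assoc)
  finally show ?thesis .
qed

lemma T_nz: "0 < Re x \<Longrightarrow> 0 \<le> K \<Longrightarrow> T K x \<noteq> 0"
proof -
  assume "0 < Re x" "0 \<le> K"
  then have "x \<noteq> 0" "complex_of_real (2 * K + 1) \<noteq> 0" by (auto simp del: of_real_add of_real_mult)
  then show ?thesis by (simp add: T_def del: of_real_add of_real_mult)
qed

text \<open>Every pole of \<open>g \<circ> V\<close> in the disc is simple and cancelled by a zero
  of \<open>P R\<close>, the other zeros of \<open>P R\<close> lie outside the disc, and
  \<open>g \<circ> V\<close> has no zeros there. So the quotient extends without zeros, and its
  bound extends to the poles by continuity.\<close>

lemma normalised_quotient:
  assumes K: "0 < K" "\<And>R \<zeta>. 0 < Re \<zeta> \<Longrightarrow> 1 \<le> cmod \<zeta> \<Longrightarrow> cmod \<zeta> \<le> 3 * R \<Longrightarrow> cmod (V \<zeta>) < \<epsilon> / 2 \<Longrightarrow> V \<zeta> \<notin> range b \<Longrightarrow>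
       cmod (P R \<zeta> * g (V \<zeta>)) \<le> K * cmod \<zeta> ^ 3 * exp (D * cmod \<zeta> powr \<sigma>)"
    and R: "R0 \<le> R"
  shows "\<exists>q. q holomorphic_on ball (of_real (R0 + R)) R \<and>
     (\<forall>x\<in>ball (of_real (R0 + R)) R. q x \<noteq> 0 \<and> cmod (q x) < 1 \<and> (x \<notin> N \<longrightarrow> q x = P R x * g (V x) / T K x))"
proof -
  define U where "U = ball (complex_of_real (R0 + R)) R"
  note dU = disc_subset[OF R, folded U_def]
  define S where "S = Z R \<inter> U"
  have fS: "finite S" using Z by (auto simp: S_def)
  have SN: "x \<in> S \<longleftrightarrow> x \<in> N" if "x \<in> U" for x
  proof -
    have "cmod x \<le> 3 * R" using dU[OF that] by simp
    also have "\<dots> \<le> \<kappa> * R" using \<kappa> R R0 by (intro mult_right_mono) auto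
    finally show ?thesis using that by (auto simp: S_def Z_def)
  qed
  have U_right: "U \<subseteq> {\<zeta>. 0 < Re \<zeta>}" using dU by auto
  have VU: "V ` U \<subseteq> ball 0 (\<epsilon> / 2) - {0}" using V_small[OF dU(3)] V_nz by auto
  have h: "(\<lambda>x. F (V x)) holomorphic_on U"
    using holomorphic_on_compose_gen[OF holomorphic_on_subset[OF V_holomorphic U_right] F_holo VU] by (simp add: o_def)
  have z: "F (V x) = 0 \<longleftrightarrow> x \<in> S" if "x \<in> U" for x
    using F_zero_iff[OF V_nz V_small[OF dU(3)[OF that]]] V_pole_iff[OF dU(4,3)[OF that]] SN[OF that] by simp
  have d: "deriv (\<lambda>x. F (V x)) x \<noteq> 0" if "x \<in> S" for x
  proof -
    have xU: "x \<in> U" using that by (auto simp: S_def)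
    have Vr: "V x \<in> range b" using that V_pole_iff[OF dU(4,3)[OF xU]] SN[OF xU] by simp
    have "F field_differentiable at (V x)" and dF: "deriv F (V x) \<noteq> 0"
      using F_derivative[of "V x"] Vr V_nz V_small[OF dU(3)[OF xU]] eps by force+
    then have "(F has_field_derivative deriv F (V x)) (at (V x))" by (simp add: field_differentiable_derivI)
    then have "((\<lambda>x. F (V x)) has_field_derivative deriv F (V x) * (- of_real \<beta> / x * V x)) (at x)"
      by (rule DERIV_chain2[OF _ V_deriv[OF dU(4)[OF xU]]])
    then have "deriv (\<lambda>x. F (V x)) x = deriv F (V x) * (- of_real \<beta> / x * V x)" by (rule DERIV_imp_deriv)
    moreover have "V x \<noteq> 0" "x \<noteq> 0" using V_nz[of x] dU(4)[OF xU] by auto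
    ultimately show ?thesis using dF params by simp
  qed
  obtain k where k: "k holomorphic_on U" "\<And>u. u \<in> U \<Longrightarrow> k u \<noteq> 0" "\<And>u. u \<in> U \<Longrightarrow> F (V u) = k u * (\<Prod>p\<in>S. u - p)"
    using factor_simple_zeros[OF fS _ _ h z d] by (auto simp: S_def U_def)
  \<comment> \<open>The quotient with the common factors already cancelled:
    \<open>F \<circ> V\<close> contributes \<open>k\<close> times the product of
    \<open>x - p\<close> over \<open>S\<close>, and \<open>1 - x / p = (- 1 / p) * (x - p)\<close>
    leaves the constants \<open>- 1 / p\<close>.\<close>
  define q where "q x = (\<Prod>p\<in>Z R - S. 1 - x / p) * (\<Prod>p\<in>S. - 1 / p) / (k x * T K x)" for x
  have Znz: "p \<noteq> 0" if "p \<in> Z R" for p using Z(1)[of R] N_norm[of p] that by auto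
  have hT: "T K holomorphic_on U"
    unfolding T_def using U_right by (intro holomorphic_intros) (auto simp: complex_nonpos_Reals_iff)
  have hq: "q holomorphic_on U"
    unfolding q_def using k T_nz[OF dU(4)] K(1) Znz by (intro holomorphic_intros hT) auto
  have qnz: "q x \<noteq> 0" if "x \<in> U" for x
    using k(2)[OF that] T_nz[OF dU(4)[OF that]] K(1) Znz Z(2) that fS
    by (auto simp: q_def S_def)
  have qeq: "q x = P R x * g (V x) / T K x" if "x \<in> U" "x \<notin> N" for x
  proof -
    have "V x \<notin> range b" using V_pole_iff[OF dU(4,3)[OF that(1)]] that by simp
    then have FV: "F (V x) = 1 / g (V x)" by (simp add: F_def)
    have "x \<notin> S" using SN that by simp
    then have gV: "g (V x) = 1 / (k x * (\<Prod>p\<in>S. x - p))" using k(3)[OF that(1)] FV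
      by (metis div_by_1 divide_divide_eq_right mult_1 inverse_eq_divide inverse_inverse_eq)
    have "P R x = (\<Prod>p\<in>Z R - S. 1 - x / p) * (\<Prod>p\<in>S. 1 - x / p)"
      unfolding P_def using Z(2) by (intro prod.subset_diff) (auto simp: S_def)
    also have "(\<Prod>p\<in>S. 1 - x / p) = (\<Prod>p\<in>S. (- 1 / p) * (x - p))"
      using Znz by (intro prod.cong) (auto simp: S_def field_simps)
    finally have "P R x = (\<Prod>p\<in>Z R - S. 1 - x / p) * ((\<Prod>p\<in>S. - 1 / p) * (\<Prod>p\<in>S. x - p))"
      by (simp only: prod.distrib)
    moreover have "(\<Prod>p\<in>S. x - p) \<noteq> 0" using \<open>x \<notin> S\<close> fS by auto
    ultimately show ?thesis unfolding q_def gV by simp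
  qed
  have half0: "cmod (q x) \<le> 1 / 2" if "x \<in> U" "x \<notin> N" for x
  proof -
    have nr: "V x \<notin> range b" using V_pole_iff[OF dU(4,3)[OF that(1)]] that by simp
    have "2 * cmod (P R x * g (V x)) \<le> 2 * (K * cmod x ^ 3 * exp (D * cmod x powr \<sigma>))"
      using K(2)[OF dU(4,5,2)[OF that(1)] V_small[OF dU(3)[OF that(1)]] nr] by simp
    also have "\<dots> \<le> (2 * K + 1) * (cmod x ^ 3 * exp (D * cmod x powr \<sigma>))" by (simp add: algebra_simps)
    also have "\<dots> \<le> cmod (T K x)" using T_ge[OF dU(4)[OF that(1)]] K(1) by simp
    finally show ?thesis unfolding qeq[OF that] using T_nz[OF dU(4)[OF that(1)], of K] K(1)
      by (simp add: norm_divide divide_simps)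
  qed
  have half: "cmod (q x) \<le> 1 / 2" if "x \<in> U" for x
  proof (cases "x \<in> N")
    case True
    have "continuous_on U q" using hq by (rule holomorphic_on_imp_continuous_on)
    then have "isCont q x" using that by (simp add: U_def continuous_on_eq_continuous_at)
    then have "((\<lambda>u. cmod (q u)) \<longlongrightarrow> cmod (q x)) (at x)" by (intro tendsto_norm) (simp add: isCont_def)
    moreover have "eventually (\<lambda>u. cmod (q u) \<le> 1 / 2) (at x)"
    proof -
      have "open (U - (S - {x}))" using fS by (intro open_Diff finite_imp_closed) (auto simp: U_def)
      moreover have "x \<in> U - (S - {x})" using that by auto
      ultimately have "eventually (\<lambda>u. u \<in> U - (S - {x})) (at x)" by (rule eventually_at_in_open')
      then show ?thesis using eventually_neq_at_within[of x x UNIV]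
        by eventually_elim (use half0 SN in auto)
    qed
    ultimately show ?thesis by (rule tendsto_upperbound) auto
  qed (use half0 that in auto)
  show ?thesis
  proof (intro exI[of _ q] conjI ballI impI)
    show "q holomorphic_on ball (of_real (R0 + R)) R" using hq by (simp only: U_def)
    fix x assume "x \<in> ball (complex_of_real (R0 + R)) R"
    then have xU: "x \<in> U" by (simp only: U_def)
    show "q x \<noteq> 0" by (rule qnz[OF xU])
    show "cmod (q x) < 1" using half[OF xU] by simp
    show "x \<notin> N \<Longrightarrow> q x = P R x * g (V x) / T K x" by (rule qeq[OF xU])
  qed
qed

section \<open>Growth of the reciprocal and removal of its singularity\<close>

lemma base_point: "\<exists>y>R0. y \<le> R0 + 1 \<and> complex_of_real y \<notin> N"
proof (rule ccontr)
  assume "\<not> ?thesis"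
  then have "of_real ` {R0<..R0 + 1} \<subseteq> {q \<in> N. cmod q \<le> R0 + 1}" using R0 by auto
  then have "finite (complex_of_real ` {R0<..R0 + 1})" using finite_N finite_subset by blast
  then have "finite {R0<..R0 + 1}" by (rule finite_imageD) (simp add: inj_on_def)
  then show False using infinite_Ioc[of R0 "R0 + 1"] by simp
qed

text \<open>The factors with \<open>|q| \<le> 2 * |x|\<close> form a fixed finite product, nonzero
  because \<open>x \<notin> N\<close>; \<open>prod_N_ge\<close> bounds all further factors. Hence
  \<open>m\<close> does not depend on \<open>R\<close>.\<close>

lemma P_base_lower:
  assumes "x \<notin> N" "x \<noteq> 0"
  obtains m where "0 < m" "\<And>R. 2 * cmod x \<le> \<kappa> * R \<Longrightarrow> m \<le> cmod (P R x)"
proof -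
  define S where "S = {q \<in> N. cmod q \<le> 2 * cmod x}"
  define m where "m = cmod (\<Prod>q\<in>S. 1 - x / q) * exp (- 2 * M * cmod x powr \<sigma>)"
  have fS: "finite S" unfolding S_def by (rule finite_N)
  have S1: "1 - x / q \<noteq> 0" if "q \<in> S" for q
    using that assms N_norm[of q] by (auto simp: S_def)
  show thesis
  proof (rule that)
    have "(\<Prod>q\<in>S. 1 - x / q) \<noteq> 0" unfolding prod_zero_iff[OF fS] using S1 by blast
    then show "0 < m" by (simp add: m_def)
    fix R assume R: "2 * cmod x \<le> \<kappa> * R"
    then have "S \<subseteq> Z R" by (auto simp: S_def Z_def)
    then have "P R x = (\<Prod>q\<in>Z R - S. 1 - x / q) * (\<Prod>q\<in>S. 1 - x / q)"
      unfolding P_def by (rule prod.subset_diff[OF _ Z(2)])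
    moreover have "exp (- 2 * M * cmod x powr \<sigma>) \<le> cmod (\<Prod>q\<in>Z R - S. 1 - x / q)"
      using Z(1)[of R] Z(2)[of R] by (intro prod_N_ge) (auto simp: S_def)
    ultimately show "m \<le> cmod (P R x)"
      by (simp add: m_def norm_mult mult.commute[of "cmod (prod _ S)"] mult_right_mono)
  qed
qed

text \<open>Harnack's inequality is applied in a disc that touches the line \<open>Re = R0\<close> at \<open>R0\<close> and has
  radius comparable to \<open>\<bar>x\<bar>\<close>. The base point \<open>y\<close> does not depend on \<open>x\<close>, so the product there is
  bounded below uniformly and only one power of \<open>\<bar>x\<bar>\<close> is lost.\<close>

lemma sector_growth:
  assumes "0 < \<eta>"
  obtains C R1 where "0 \<le> C" "R0 < R1" "\<And>x. R1 \<le> cmod x \<Longrightarrow> \<eta> * cmod x \<le> Re x \<Longrightarrow> cmod (F (V x)) \<le> exp (C * cmod x)"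
proof -
  obtain K where K: "0 < K" "\<And>R \<zeta>. 0 < Re \<zeta> \<Longrightarrow> 1 \<le> cmod \<zeta> \<Longrightarrow> cmod \<zeta> \<le> 3 * R \<Longrightarrow> cmod (V \<zeta>) < \<epsilon> / 2 \<Longrightarrow> V \<zeta> \<notin> range b \<Longrightarrow>
       cmod (P R \<zeta> * g (V \<zeta>)) \<le> K * cmod \<zeta> ^ 3 * exp (D * cmod \<zeta> powr \<sigma>)"
    using P_g_bound by blast
  obtain y where y: "R0 < y" "y \<le> R0 + 1" "complex_of_real y \<notin> N" using base_point by blast
  define Y where "Y = complex_of_real y"
  have Y: "0 < Re Y" "cmod Y = y" "R0 < cmod Y" "Y \<noteq> 0" "Y \<notin> N" using y R0 by (auto simp: Y_def)
  obtain m where m: "0 < m" "\<And>R. 2 * cmod Y \<le> \<kappa> * R \<Longrightarrow> m \<le> cmod (P R Y)"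
    using P_base_lower[OF Y(5,4)] by blast
  have gY: "g (V Y) \<noteq> 0"
    using nozero[OF V_nz V_small[OF Y(3)]] V_pole_iff[OF Y(1,3)] Y(5) by simp
  \<comment> \<open>A lower bound at the base point for the quotients of all the discs at
    once.\<close>
  define m0 where "m0 = m * cmod (g (V Y)) / cmod (T K Y)"
  have m0: "m0 > 0" using m gY T_nz[OF Y(1)] K(1) by (simp add: m0_def)
  define L where "L = max 0 (- ln m0)"
  define \<eta>' where "\<eta>' = min (\<eta> / 4) 1"
  have \<eta>': "0 < \<eta>'" "\<eta>' \<le> \<eta> / 4" "\<eta>' \<le> 1" using assms by (auto simp: \<eta>'_def)
  define C where "C = 16 * L / (\<eta>' ^ 3 * (y - R0))"
  define R1 where "R1 = 3 * R0 + 2 * y + 2 * R0 / \<eta>"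
  have "0 \<le> 2 * R0 / \<eta>" using R0 assms by simp
  then have R1: "R0 < R1" "2 * R0 \<le> R1" "R0 + 2 * y \<le> R1" "2 * R0 / \<eta> \<le> R1"
    unfolding R1_def using y R0 by linarith+
  have C0: "0 \<le> C" using \<eta>' y by (auto simp: C_def L_def)
  show thesis
  proof (rule that[OF C0 R1(1)])
    fix x assume x: "R1 \<le> cmod x" "\<eta> * cmod x \<le> Re x"
    have x0: "0 < cmod x" using x R1 R0 by linarith
    have xr: "0 < Re x" using x x0 assms by (meson less_le_trans mult_pos_pos)
    have xR0: "R0 < cmod x" using x R1 by linarith
    show "cmod (F (V x)) \<le> exp (C * cmod x)"
    proof (cases "x \<in> N")
      case True
      then have "V x \<in> range b" using V_pole_iff[OF xr xR0] by simp
      then show ?thesis by (simp add: F_def)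
    next
      case False
      define x' where "x' = x - of_real R0"
      have "cmod x \<le> cmod x' + R0" "cmod x' \<le> cmod x + R0"
        using norm_triangle_ineq[of x' "of_real R0"] norm_triangle_ineq4[of x "of_real R0"] R0 by (auto simp: x'_def)
      then have nx': "cmod x' \<le> 2 * cmod x" "2 * y \<le> cmod x'" "R0 \<le> cmod x'" "0 < cmod x'"
        using x R1 R0 y by linarith+
      have re': "\<eta>' * cmod x' \<le> Re x'"
      proof -
        have "2 * R0 \<le> \<eta> * R1" using R1(4) assms by (simp add: field_simps)
        also have "\<dots> \<le> \<eta> * cmod x" using x assms by simp
        finally have "\<eta> * cmod x / 2 \<le> Re x'" using x by (simp add: x'_def)
        moreover have "\<eta>' * cmod x' \<le> (\<eta> / 4) * (2 * cmod x)" using \<eta>' nx' by (intro mult_mono) auto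
        ultimately show ?thesis by simp
      qed
      have rex': "0 < Re x'" using re' \<eta>' nx' by (meson less_le_trans mult_pos_pos)
      \<comment> \<open>Twice the radius of the circle touching the line at \<open>R0\<close> and
        passing through \<open>x\<close>. It makes \<open>dist c x ^ 2 = R ^ 2 - |x'| ^ 2\<close>,
        so \<open>x\<close> has distance at least \<open>|x'| ^ 2 / (2 * R)\<close> from the
        boundary, with \<open>R\<close> comparable to \<open>|x'|\<close>.\<close>
      define R where "R = cmod x' ^ 2 / Re x'"
      have Rge: "cmod x' \<le> R"
        using complex_Re_le_cmod[of x'] rex' nx' mult_left_mono[OF complex_Re_le_cmod[of x'], of "cmod x'"]
        by (simp add: R_def field_simps power2_eq_square)
      have Rle: "R \<le> cmod x' / \<eta>'"
      proof -
        have "R \<le> cmod x' ^ 2 / (\<eta>' * cmod x')"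
          unfolding R_def using re' rex' \<eta>' nx' by (intro divide_left_mono mult_pos_pos) auto
        then show ?thesis using nx' by (simp add: power2_eq_square)
      qed
      have R: "R0 \<le> R" "2 * y \<le> R" "0 < R" using Rge nx' by linarith+
      have "2 * cmod Y \<le> 3 * R" using R Y(2) by simp
      also have "\<dots> \<le> \<kappa> * R" using \<kappa> R by (intro mult_right_mono) auto
      finally have RY: "2 * cmod Y \<le> \<kappa> * R" .
      define c where "c = complex_of_real (R0 + R)"
      have "\<exists>q. q holomorphic_on ball c R \<and>
        (\<forall>x\<in>ball c R. q x \<noteq> 0 \<and> cmod (q x) < 1 \<and> (x \<notin> N \<longrightarrow> q x = P R x * g (V x) / T K x))"
        unfolding c_def by (rule normalised_quotient[OF K(1) _ R(1)]) (rule K(2))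
      then obtain q where q: "q holomorphic_on ball c R" "\<And>x. x \<in> ball c R \<Longrightarrow> q x \<noteq> 0" "\<And>x. x \<in> ball c R \<Longrightarrow> cmod (q x) < 1"
        "\<And>x. x \<in> ball c R \<Longrightarrow> x \<notin> N \<Longrightarrow> q x = P R x * g (V x) / T K x"
        by blast
      have dY: "dist c Y = R - (y - R0)"
      proof -
        have "c - Y = of_real (R - (y - R0))" by (simp add: c_def Y_def)
        then show ?thesis using R y R0 unfolding dist_norm by (simp only: norm_of_real)
      qed
      have dx: "(dist c x)^2 = R^2 - cmod x' ^ 2"
      proof -
        have "c - x = of_real R - x'" by (simp add: c_def x'_def)
        then have "(dist c x)^2 = (R - Re x')^2 + (Im x')^2" by (simp add: dist_norm cmod_power2)
        also have "\<dots> = R^2 - 2 * (R * Re x') + ((Re x')^2 + (Im x')^2)" by (simp add: power2_diff)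
        also have "R * Re x' = cmod x' ^ 2" using rex' by (simp add: R_def)
        finally show ?thesis by (simp add: cmod_power2)
      qed
      have dxR: "dist c x < R"
      proof -
        have "(dist c x)^2 < R^2" unfolding dx using nx' by simp
        then show ?thesis by (rule power2_less_imp_less) (use R in simp)
      qed
      have xb: "x \<in> ball c R" using dxR by simp
      have Yb: "Y \<in> ball c R" using dY y by simp
      have mY: "m0 \<le> cmod (q Y)"
        unfolding q(4)[OF Yb Y(5)] m0_def norm_divide norm_mult using m(2)[OF RY]
        by (intro divide_right_mono mult_right_mono) auto
      have "ln m0 \<le> ln (cmod (q Y))" using mY m0 by (intro ln_mono) auto
      then have lnY: "- ln (cmod (q Y)) \<le> L" by (simp add: L_def max_def)
      have lnx: "0 < - ln (cmod (q x))" using q(2,3)[OF xb] by simp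
      have gap: "cmod x' ^ 2 / (2 * R) \<le> R - dist c x"
      proof -
        have "cmod x' ^ 2 = (R - dist c x) * (R + dist c x)" using dx by (simp add: algebra_simps power2_eq_square)
        also have "\<dots> \<le> (R - dist c x) * (2 * R)" using dxR by (intro mult_left_mono) auto
        finally show ?thesis using R by (simp add: field_simps)
      qed
      \<comment> \<open>The gap at \<open>Y\<close> is the constant \<open>y - R0\<close>, that at
        \<open>x\<close> is of order \<open>|x'|\<close>; dividing Harnack's \<open>R ^ 2\<close> by
        both leaves one power of \<open>|x'|\<close>.\<close>
      have "- ln (cmod (q x)) * (cmod x' ^ 2 / (2 * R) * (y - R0)) \<le> - ln (cmod (q x)) * ((R - dist c x) * (R - dist c Y))"
        using gap lnx y dY dxR by (intro mult_left_mono mult_mono) auto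
      also have "\<dots> \<le> - ln (cmod (q Y)) * (4 * R^2)"
        by (rule harnack_zero_free[OF q(1,2,3) xb Yb])
      also have "\<dots> \<le> L * (4 * R^2)" using lnY by (intro mult_right_mono) auto
      finally have "- ln (cmod (q x)) * (cmod x' ^ 2 * (y - R0)) \<le> 8 * L * R ^ 3"
        using R by (simp add: field_simps power2_eq_square power3_eq_cube)
      also have "\<dots> \<le> 8 * L * (cmod x' / \<eta>') ^ 3"
        using Rle R by (intro mult_left_mono power_mono) (simp_all add: L_def)
      also have "\<dots> = (8 * L / \<eta>' ^ 3 * cmod x') * cmod x' ^ 2" by (simp add: power_divide power2_eq_square power3_eq_cube)
      finally have "(- ln (cmod (q x)) * (y - R0)) * cmod x' ^ 2 \<le> (8 * L / \<eta>' ^ 3 * cmod x') * cmod x' ^ 2"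
        by (simp add: mult_ac)
      then have "- ln (cmod (q x)) * (y - R0) \<le> 8 * L / \<eta>' ^ 3 * cmod x'"
        by (rule mult_right_le_imp_le) (use nx' in simp)
      also have "\<dots> \<le> 8 * L / \<eta>' ^ 3 * (2 * cmod x)"
        using nx' \<eta>' by (intro mult_left_mono) (auto simp: L_def)
      also have "\<dots> = C * cmod x * (y - R0)" using y \<eta>' by (simp add: C_def field_simps)
      finally have ln_bound: "- ln (cmod (q x)) \<le> C * cmod x"
        by (rule mult_right_le_imp_le) (use y in simp)
      have nr: "V x \<notin> range b" using V_pole_iff[OF xr xR0] False by simp
      have gx: "g (V x) \<noteq> 0" by (rule nozero[OF V_nz V_small[OF xR0] nr])
      have Tx: "T K x \<noteq> 0" using T_nz[OF xr] K(1) by simp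
      have PT: "cmod (P R x) \<le> cmod (T K x)"
      proof -
        have "1 \<le> cmod x ^ 3" using xR0 R0 by simp
        then have "1 * (1 * exp (D * cmod x powr \<sigma>)) \<le> (2 * K + 1) * (cmod x ^ 3 * exp (D * cmod x powr \<sigma>))"
          using K(1) by (intro mult_mono) auto
        also have "\<dots> \<le> cmod (T K x)" using T_ge[OF xr] K(1) by simp
        finally show ?thesis using P_bound[of R x] by simp
      qed
      \<comment> \<open>\<open>g (V x)\<close> cancels, so a lower bound for \<open>q\<close> is an
        upper bound for \<open>F\<close>.\<close>
      have "cmod (F (V x)) * cmod (q x) = cmod (P R x) / cmod (T K x)"
        using nr gx by (simp add: F_def q(4)[OF xb False] norm_divide norm_mult)
      also have "\<dots> \<le> 1" using PT Tx by (simp add: divide_le_eq)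
      finally have "cmod (F (V x)) \<le> 1 / cmod (q x)" using q(2)[OF xb] by (simp add: field_simps)
      also have "\<dots> = exp (- ln (cmod (q x)))" using q(2)[OF xb] by (simp add: exp_minus divide_inverse)
      also have "\<dots> \<le> exp (C * cmod x)" using ln_bound by simp
      finally show ?thesis .
    qed
  qed
qed

text \<open>With \<open>v = exp (- x)\<close> the sector becomes the half-strip
  \<open>|Im x| \<le> s\<close> and \<open>W v = exp (\<gamma> * x)\<close>, so
  \<open>sector_growth\<close> takes the form \<open>exp (C * exp (\<gamma> * Re x))\<close> with
  \<open>\<gamma> * s < pi / 2\<close>. The long sides are covered by \<open>lower\<close>, the
  short one by compactness.\<close>

lemma F_bounded: "\<exists>B x0. \<forall>v. 0 < cmod v \<longrightarrow> cmod v \<le> exp (- x0) \<longrightarrow> cmod (F v) \<le> B"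
proof -
  have c: "0 < cos (\<gamma> * s)" using params angles by (intro cos_gt_zero_pi) (auto intro: less_trans[of _ 0])
  obtain C R1 where C: "0 \<le> C" "R0 < R1"
    "\<And>x. R1 \<le> cmod x \<Longrightarrow> cos (\<gamma> * s) * cmod x \<le> Re x \<Longrightarrow> cmod (F (V x)) \<le> exp (C * cmod x)"
    using sector_growth[OF c] by blast
  define U where "U = {x. \<beta> * ln R0 < Re x}"
  define x0 where "x0 = \<beta> * ln R1"
  have x0: "\<beta> * ln R0 < x0" unfolding x0_def using C(2) R0 params by simp
  have modR: "R1 \<le> exp (\<gamma> * X)" if "x0 \<le> X" for X
  proof -
    have "\<gamma> * (\<beta> * ln R1) \<le> \<gamma> * X" using that params unfolding x0_def by (intro mult_left_mono) auto
    moreover have "\<gamma> * (\<beta> * ln R1) = ln R1" using params(5) by (simp add: mult.assoc[symmetric])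
    ultimately have "exp (ln R1) \<le> exp (\<gamma> * X)" by simp
    then show ?thesis using C(2) R0 by simp
  qed
  have WE: "W (exp (- x)) = exp (of_real \<gamma> * x)" and AE: "Arg (exp (- x)) = - Im x" if "\<bar>Im x\<bar> \<le> s" for x
  proof -
    have "Ln (exp (- x)) = - x" using that angles by (intro Ln_exp) auto
    then show "W (exp (- x)) = exp (of_real \<gamma> * x)" "Arg (exp (- x)) = - Im x"
      by (simp_all add: W_def Arg_eq_Im_Ln)
  qed
  have expU: "exp (- x) \<in> ball 0 (\<epsilon> / 2) - {0}" if "x \<in> U" for x
  proof -
    have e: "(\<epsilon> / 2) = R0 powr (- \<beta>)" using eps params by (simp add: R0_def powr_powr)
    have "exp (- Re x) < exp (- (\<beta> * ln R0))" using that by (simp add: U_def)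
    also have "\<dots> = \<epsilon> / 2" unfolding e using R0 by (simp add: powr_def)
    finally show ?thesis by simp
  qed
  have hU: "open U" "(\<lambda>x. F (exp (- x))) holomorphic_on U"
  proof -
    show "open U" unfolding U_def by (rule open_halfspace_Re_gt)
    have "(\<lambda>x. exp (- x)) holomorphic_on U" by (intro holomorphic_intros)
    moreover have "(\<lambda>x. exp (- x)) ` U \<subseteq> ball 0 (\<epsilon> / 2) - {0}"
      by (rule image_subsetI) (rule expU)
    ultimately show "(\<lambda>x. F (exp (- x))) holomorphic_on U"
      by (rule holomorphic_on_compose_gen[OF _ F_holo, unfolded o_def])
  qed
  define Q where "Q = cbox (Complex x0 (- s)) (Complex x0 s)"
  have Q: "x \<in> Q \<longleftrightarrow> Re x = x0 \<and> \<bar>Im x\<bar> \<le> s" for x by (auto simp: Q_def in_cbox_complex_iff)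
  have "continuous_on Q (\<lambda>x. F (exp (- x)))"
    using x0 by (intro continuous_on_subset[OF holomorphic_on_imp_continuous_on[OF hU(2)]]) (auto simp: Q U_def)
  then have "bounded ((\<lambda>x. F (exp (- x))) ` Q)"
    unfolding Q_def by (intro compact_imp_bounded compact_continuous_image) auto
  then obtain B0 where B0: "\<And>x. x \<in> Q \<Longrightarrow> cmod (F (exp (- x))) \<le> B0" unfolding bounded_iff by auto
  define B where "B = max (max B0 (1 / c0)) 1"
  have Fout: "cmod (F v) \<le> B" if "0 < cmod v" "cmod v < \<epsilon> / 2" "s \<le> \<bar>Arg v\<bar>" for v
  proof (cases "v \<in> range b")
    case True
    then show ?thesis by (simp add: F_def B_def)
  next
    case False
    then have "c0 \<le> cmod (g v)" using lower that by simp
    then have "1 / cmod (g v) \<le> 1 / c0" using c0 by (intro divide_left_mono mult_pos_pos) auto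
    then show ?thesis using False by (simp add: F_def B_def norm_divide)
  qed
  have strip: "cmod (F (exp (- x))) \<le> B" if "x0 \<le> Re x" "\<bar>Im x\<bar> \<le> s" for x
  proof (rule phragmen_lindelof_half_strip[where F = "\<lambda>x. F (exp (- x))" and C = C and ?x0.0 = x0 and s = s and \<gamma> = \<gamma>, OF hU(2,1)])
    show "x0 \<le> Re u \<Longrightarrow> \<bar>Im u\<bar> \<le> s \<Longrightarrow> u \<in> U" for u using x0 by (auto simp: U_def)
    show "0 < s" "\<gamma> * s < pi / 2" "0 < \<gamma>" "0 \<le> C" "0 < B" using params angles C by (auto simp: B_def)
    show "cmod (F (exp (- u))) \<le> B" if "x0 \<le> Re u" "\<bar>Im u\<bar> = s" for u
      using expU[of u] that x0 by (intro Fout) (auto simp: U_def AE)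
    show "cmod (F (exp (- u))) \<le> B" if "x0 = Re u" "\<bar>Im u\<bar> \<le> s" for u
      using B0[of u] that by (auto simp: Q B_def)
    show "cmod (F (exp (- u))) \<le> exp (C * exp (\<gamma> * Re u))" if u: "x0 \<le> Re u" "\<bar>Im u\<bar> \<le> s" for u
    proof -
      define w where "w = exp (of_real \<gamma> * u)"
      have nw: "cmod w = exp (\<gamma> * Re u)" by (simp add: w_def)
      have "V w = exp (- u)" unfolding w_def WE[OF u(2), symmetric]
        using u angles by (intro V_W) (auto simp: AE)
      moreover have "cos (\<gamma> * s) * cmod w \<le> Re w"
      proof -
        have "\<gamma> * \<bar>Im u\<bar> \<le> \<gamma> * s" using u params(2) by (intro mult_left_mono) auto
        moreover have "0 \<le> \<gamma> * \<bar>Im u\<bar>" using params(2) by simp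
        moreover have "\<gamma> * s \<le> pi" using params(9) pi_gt_zero by linarith
        ultimately have "cos (\<gamma> * s) \<le> cos (\<gamma> * \<bar>Im u\<bar>)" by (intro cos_monotone_0_pi_le)
        also have "\<dots> = cos (\<gamma> * Im u)" by (cases "Im u \<ge> 0") auto
        finally show ?thesis unfolding nw w_def by (simp add: Re_exp)
      qed
      moreover have "R1 \<le> cmod w" unfolding nw by (rule modR[OF u(1)])
      ultimately show ?thesis using C(3)[of w] by (simp add: nw)
    qed
  qed (use that in auto)
  have "cmod (F v) \<le> B" if v: "0 < cmod v" "cmod v \<le> exp (- x0)" for v
  proof (cases "\<bar>Arg v\<bar> \<le> s")
    case True
    have v0: "v \<noteq> 0" using v by auto
    have "ln (cmod v) \<le> - x0" using v by (metis ln_exp ln_le_cancel_iff exp_gt_zero)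
    then have "cmod (F (exp (- (- Ln v)))) \<le> B"
      using True v0 by (intro strip) (auto simp: Arg_eq_Im_Ln)
    then show ?thesis using v0 by simp
  next
    case False
    have "exp (- x0) < \<epsilon> / 2" using expU[of "of_real x0"] x0 by (simp add: U_def)
    then show ?thesis using False v by (intro Fout) auto
  qed
  then show ?thesis by blast
qed

text \<open>The holomorphic extension of \<open>F\<close> across 0 vanishes at the poles; if these
  accumulate at 0 it vanishes identically, although \<open>F\<close> is nonzero at the image of the
  base point \<open>y\<close>.\<close>

lemma no_accumulation: "\<not> 0 islimpt range b"
proof
  assume lim: "0 islimpt range b"
  define U where "U = ball (0::complex) (\<epsilon> / 2)"
  have U: "open U" "connected U" "0 \<in> U" using eps by (auto simp: U_def)
  obtain B x0 where B: "\<And>v. 0 < cmod v \<Longrightarrow> cmod v \<le> exp (- x0) \<Longrightarrow> cmod (F v) \<le> B"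
    using F_bounded by blast
  have "eventually (\<lambda>v. cmod (F v) \<le> B) (at 0)"
    unfolding eventually_at by (intro exI[of _ "exp (- x0)"]) (auto intro!: B)
  then obtain h where h: "h holomorphic_on U" "\<And>v. v \<in> U - {0} \<Longrightarrow> h v = F v"
    using holomorphic_on_extend_bounded[of F U 0] F_holo U by (auto simp: U_def)
  have lim': "0 islimpt (range b \<inter> U)" 
    using lim U by (metis islimpt_Int_eventually eventually_at_in_open' inf_commute)
  obtain y where y: "R0 < y" "y \<le> R0 + 1" "complex_of_real y \<notin> N" using base_point by blast
  define v where "v = V (of_real y)"
  have yr: "0 < Re (complex_of_real y)" "R0 < cmod (complex_of_real y)" using y R0 by auto
  have v: "v \<notin> range b" "v \<in> U - {0}" using V_pole_iff[OF yr] y V_small[OF yr(2)] V_nz[of "of_real y"] by (auto simp: v_def U_def)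
  have "h v = 0"
  proof (rule analytic_continuation[OF h(1) U(1,2) _ U(3) lim'])
    show "h u = 0" if "u \<in> range b \<inter> U" for u
    proof -
      have "u \<noteq> 0" using that b_nz by auto
      then show ?thesis using h(2)[of u] that by (simp add: F_def)
    qed
  qed (use v in auto)
  moreover have "F v \<noteq> 0" using F_zero_iff[of v] v by (auto simp: U_def)
  ultimately show False using h(2)[OF v(2)] by simp
qed

end

section \<open>Lower bounds off the sector, and zeros\<close>

text \<open>For \<open>r > 0\<close> the sign is that of the inner product of \<open>u\<close> and
  \<open>w\<close>: a half-plane condition on the poles becomes positivity of the terms multiplied
  by \<open>u\<close>.\<close>

lemma Re_mult_divide: "Re (u * (of_real r / w)) = r * Re (cnj u * w) / cmod w ^ 2"
proof -
  have "of_real r / w = of_real (r / cmod w ^ 2) * cnj w"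
    by (subst complex_div_cnj) simp
  then have "Re (u * (of_real r / w)) = r / cmod w ^ 2 * Re (u * cnj w)"
    by (simp del: of_real_divide add: algebra_simps)
  then show ?thesis by simp
qed

text \<open>Adding \<open>h\<close> makes all terms nonnegative, so a finite part bounds the whole
  series from below.\<close>

lemma Re_suminf_ge_sum:
  fixes f :: "nat \<Rightarrow> complex"
  assumes "summable f" "summable h" "\<And>k. - h k \<le> Re (f k)" "finite S"
  shows "(\<Sum>k\<in>S. Re (f k) + h k) \<le> Re (suminf f) + suminf h"
proof -
  have S: "(\<lambda>k. Re (f k) + h k) sums (Re (suminf f) + suminf h)"
    using assms by (intro sums_add sums_Re summable_sums)
  have "0 \<le> Re (f k) + h k" for k using assms(3)[of k] by linarith
  then have "(\<Sum>k\<in>S. Re (f k) + h k) \<le> (\<Sum>k. Re (f k) + h k)"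
    using assms(4) by (intro sum_le_suminf sums_summable[OF S]) auto
  then show ?thesis by (simp only: sums_unique[OF S, symmetric])
qed

section \<open>Lower bounds for \<open>g\<close> outside the sector of the poles\<close>

context pole_sum
begin

lemma summable_terms:
  assumes "0 < cmod v" "cmod v < \<epsilon>" "v \<notin> range b"
  shows "summable (\<lambda>k. of_real (a k) / (b k - v) :: complex)"
proof -
  obtain d where d: "d > 0" "\<And>k. b k \<noteq> v \<Longrightarrow> d \<le> dist v (b k)" using isolated[OF assms(1,2)] by blast
  have "cmod (of_real (a k) / (b k - v)) \<le> a k / d" for k
  proof -
    have "b k \<noteq> v" using assms(3) by (metis rangeI)
    then have "d \<le> cmod (b k - v)" using d(2)[of k] by (simp add: dist_norm norm_minus_commute)
    then show ?thesis using d(1) a_pos[of k] by (auto simp: norm_divide intro!: divide_left_mono mult_pos_pos)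
  qed
  then show ?thesis by (intro summable_comparison_test'[OF summable_divide[OF a_sum, of d]]) auto
qed

text \<open>For \<open>Re v \<le> 0\<close> every term has nonnegative real part, so the term with
  index 0 alone gives the bound; \<open>|v| < \<epsilon> \<le> 1\<close> accounts for the
  denominator.\<close>

lemma lower_bound_left:
  assumes "0 < cmod v" "cmod v < \<epsilon>" "v \<notin> range b" "Re v \<le> 0"
  shows "a 0 * Re (b 0) / (cmod (b 0) + 1) ^ 2 \<le> cmod (g v)"
proof -
  have pos: "0 \<le> Re (of_real (a k) / (b k - v))" for k
    using Re_mult_divide[of 1 "a k" "b k - v"] a_pos[of k] b_re[of k] assms(4) by simp
  have "a 0 * Re (b 0) / (cmod (b 0) + 1) ^ 2 \<le> a 0 * Re (b 0 - v) / cmod (b 0 - v) ^ 2"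
  proof (intro frac_le mult_left_mono mult_nonneg_nonneg power_mono)
    show "cmod (b 0 - v) \<le> cmod (b 0) + 1"
      using norm_triangle_ineq4[of "b 0" v] assms(2) eps by linarith
    show "0 < cmod (b 0 - v) ^ 2" using assms(3) by (metis rangeI right_minus_eq zero_less_norm_iff zero_less_power)
  qed (use a_pos[of 0] b_re[of 0] assms(4) in auto)
  also have "\<dots> = Re (of_real (a 0) / (b 0 - v))" using Re_mult_divide[of 1 "a 0" "b 0 - v"] by simp
  also have "\<dots> \<le> Re (g v)"
    using Re_suminf_ge_sum[OF summable_terms[OF assms(1-3)] summable_zero, of "{0}"] pos
    by (simp add: g_def)
  also have "\<dots> \<le> cmod (g v)" by (rule complex_Re_le_cmod)
  finally show ?thesis .
qed

text \<open>Rotated by the angle from \<open>separating_direction\<close>, the terms of all poles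
  within \<open>\<epsilon>\<close> have positive real part. If \<open>a k / |b k|\<close> is
  summable, this separation dominates the series up to the vertex 0; if not, these terms outgrow the
  bounded contribution of the far poles.\<close>

lemma lower_bound_sector:
  assumes p: "0 \<le> p" "p < s" "s < pi / 2" and b_Arg: "\<And>k. cmod (b k) \<le> \<epsilon> \<Longrightarrow> \<bar>Arg (b k)\<bar> \<le> p"
  shows "\<exists>c>0. \<exists>r>0. \<forall>v. 0 < cmod v \<longrightarrow> cmod v < r \<longrightarrow> s \<le> \<bar>Arg v\<bar> \<longrightarrow> v \<notin> range b \<longrightarrow> c \<le> cmod (g v)"
proof -
  from separating_direction[OF p] obtain c where c: "c > 0"
    and dir: "\<forall>y. s \<le> \<bar>y\<bar> \<longrightarrow> \<bar>y\<bar> \<le> pi \<longrightarrow> (\<exists>\<alpha>. (\<forall>x. \<bar>x\<bar> \<le> p \<longrightarrow> c \<le> cos (x - \<alpha>)) \<and> cos (y - \<alpha>) \<le> - c)"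
    by (elim exE conjE)
  have near: "\<exists>\<alpha>. \<forall>k. cmod (b k) \<le> \<epsilon> \<longrightarrow> c * (cmod (b k) + cmod v) \<le> Re (cis (- \<alpha>) * (b k - v))" if "s \<le> \<bar>Arg v\<bar>" for v
  proof -
    have polar: "Re (cis (- \<alpha>) * w) = cmod w * cos (Arg w - \<alpha>)" for w \<alpha>
    proof -
      have "cis (- \<alpha>) * w = of_real (cmod w) * (cis (- \<alpha>) * cis (Arg w))"
        by (subst (1) rcis_cmod_Arg[symmetric]) (simp add: rcis_def mult_ac)
      then show ?thesis by (simp add: cis_mult)
    qed
    have "\<bar>Arg v\<bar> \<le> pi" using Arg_bounded[of v] by linarith
    from dir[rule_format, OF that this] obtain \<alpha> where \<alpha>: "\<And>x. \<bar>x\<bar> \<le> p \<Longrightarrow> c \<le> cos (x - \<alpha>)" "cos (Arg v - \<alpha>) \<le> - c"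
      by blast
    have "c * (cmod (b k) + cmod v) \<le> Re (cis (- \<alpha>) * (b k - v))" if "cmod (b k) \<le> \<epsilon>" for k
    proof -
      have "cmod (b k) * c \<le> cmod (b k) * cos (Arg (b k) - \<alpha>)"
        using \<alpha>(1)[OF b_Arg[OF that]] by (intro mult_left_mono) auto
      moreover have "cmod v * cos (Arg v - \<alpha>) \<le> cmod v * (- c)" using \<alpha>(2) by (intro mult_left_mono) auto
      moreover have "Re (cis (- \<alpha>) * (b k - v)) = cmod (b k) * cos (Arg (b k) - \<alpha>) - cmod v * cos (Arg v - \<alpha>)"
        unfolding right_diff_distrib minus_complex.simps polar ..
      ultimately show ?thesis by (simp add: algebra_simps)
    qed
    then show ?thesis by blast
  qed
  show ?thesis
  proof (cases "summable (\<lambda>k. a k / cmod (b k))")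
    case True
    define c' where "c' = min c (1 / 2)"
    have c': "0 < c'" "c' \<le> c" "c' \<le> 1 / 2" using c by (auto simp: c'_def)
    \<comment> \<open>The vertex is added by hand because \<open>Arg 0 = 0\<close>.\<close>
    define Q where "Q = {v. cmod v < \<epsilon> / 2 \<and> (v = 0 \<or> s \<le> \<bar>Arg v\<bar>)}"
    have dist: "c' * cmod (b k) \<le> cmod (b k - v)" if v: "v \<in> Q" for k v
    proof -
      consider "v = 0" | "cmod (b k) > \<epsilon>" | "cmod (b k) \<le> \<epsilon>" "s \<le> \<bar>Arg v\<bar>" using v by (force simp: Q_def)
      then show ?thesis
      proof cases
        case 1
        then show ?thesis using mult_right_mono[of c' 1 "cmod (b k)"] c' by simp
      next
        case 2
        have "c' * cmod (b k) \<le> 1 / 2 * cmod (b k)" using c' by (intro mult_right_mono) auto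
        also have "\<dots> \<le> cmod (b k) - cmod v" using 2 v by (simp add: Q_def)
        also have "\<dots> \<le> cmod (b k - v)" by (rule norm_triangle_ineq2)
        finally show ?thesis .
      next
        case 3
        then obtain \<alpha> where \<alpha>: "c * (cmod (b k) + cmod v) \<le> Re (cis (- \<alpha>) * (b k - v))" using near by blast
        have "c' * cmod (b k) \<le> c * (cmod (b k) + cmod v)" using c' by (intro mult_mono) auto
        also note \<alpha>
        also have "Re (cis (- \<alpha>) * (b k - v)) \<le> cmod (cis (- \<alpha>) * (b k - v))" by (rule complex_Re_le_cmod)
        finally show ?thesis by (simp add: norm_mult)
      qed
    qed
    have ne: "b k - v \<noteq> 0" if "v \<in> Q" for k v
      using dist[OF that, of k] c' b_nz[of k] by (auto simp: mult_le_0_iff)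
    have "uniform_limit Q (\<lambda>n v. \<Sum>k<n. of_real (a k) / (b k - v)) g sequentially"
      unfolding g_def
    proof (rule Weierstrass_m_test[where M = "\<lambda>k. a k / cmod (b k) / c'"])
      show "cmod (of_real (a k) / (b k - v)) \<le> a k / cmod (b k) / c'" if "v \<in> Q" for k v
      proof -
        have "a k / cmod (b k - v) \<le> a k / (c' * cmod (b k))"
          using dist[OF that, of k] ne[OF that] a_pos[of k] c' b_nz[of k] by (intro divide_left_mono mult_pos_pos) auto
        then show ?thesis using a_pos[of k] by (simp add: norm_divide mult_ac)
      qed
      show "summable (\<lambda>k. a k / cmod (b k) / c')" using True by (rule summable_divide)
    qed
    then have "continuous_on Q g"
    proof (rule uniform_limit_theorem[rotated])
      have "continuous_on Q (\<lambda>v. of_real (a k) / (b k - v))" for k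
        by (intro continuous_intros ballI ne)
      then show "\<forall>\<^sub>F n in sequentially. continuous_on Q (\<lambda>v. \<Sum>k<n. of_real (a k) / (b k - v))"
        by (intro always_eventually allI continuous_on_sum)
    qed simp
    moreover have Q0: "0 \<in> Q" using eps by (simp add: Q_def)
    moreover have g0: "0 < Re (g 0)"
    proof -
      have S: "summable (\<lambda>k. of_real (a k) / (b k - 0) :: complex)"
      proof (rule summable_comparison_test'[OF True])
        show "cmod (of_real (a k) / (b k - 0)) \<le> a k / cmod (b k)" for k using a_pos[of k] by (simp add: norm_divide)
      qed
      have P: "0 < Re (of_real (a k) / (b k - 0))" for k
      proof -
        have "0 < a k * Re (b k) / cmod (b k) ^ 2" using a_pos[of k] b_re[of k] b_nz[of k] by (intro divide_pos_pos mult_pos_pos) auto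
        then show ?thesis using Re_mult_divide[of 1 "a k" "b k - 0"] by simp
      qed
      have "(\<Sum>k. Re (of_real (a k) / (b k - 0))) > 0" using P summable_Re[OF S] by (intro suminf_pos)
      then show ?thesis unfolding g_def using Re_suminf[OF S] by simp
    qed
    ultimately obtain d where d: "d > 0" "\<And>v. v \<in> Q \<Longrightarrow> dist v 0 < d \<Longrightarrow> dist (g v) (g 0) < Re (g 0) / 2"
      unfolding continuous_on_iff by (metis half_gt_zero)
    have "Re (g 0) / 2 \<le> cmod (g v)" if "cmod v < min d (\<epsilon> / 2)" "s \<le> \<bar>Arg v\<bar>" for v
    proof -
      have "cmod (g v - g 0) < Re (g 0) / 2" using d(2)[of v] that by (simp add: Q_def dist_norm)
      then show ?thesis using norm_triangle_ineq2[of "g 0" "g v"] complex_Re_le_cmod[of "g 0"]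
        unfolding norm_minus_commute[of "g 0"] by linarith
    qed
    then show ?thesis using d eps g0
      by (intro exI[of _ "Re (g 0) / 2"] conjI exI[of _ "min d (\<epsilon> / 2)"]) auto
  next
    case False
    define h where "h k = (if cmod (b k) \<le> \<epsilon> then a k / cmod (b k) else 0)" for k
    define A where "A = suminf a"
    \<comment> \<open>Chosen so that \<open>c / 2 * L\<close> exceeds the allowance
      \<open>2 / \<epsilon> * A\<close> for far poles by 1.\<close>
    define L where "L = 2 * (2 / \<epsilon> * A + 1) / c"
    have h0: "0 \<le> h k" for k using a_pos[of k] by (simp add: h_def)
    have "\<not> summable h"
    proof
      assume "summable h"
      then have "summable (\<lambda>k. h k + a k / \<epsilon>)" using a_sum by (intro summable_add summable_divide)
      then have "summable (\<lambda>k. a k / cmod (b k))"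
      proof (rule summable_comparison_test')
        show "norm (a k / cmod (b k)) \<le> h k + a k / \<epsilon>" for k
          using a_pos[of k] eps b_nz[of k] by (auto simp: h_def intro!: divide_left_mono mult_pos_pos)
      qed
      then show False using False by contradiction
    qed
    then have "\<exists>n. L < (\<Sum>k<n. h k)"
      by (rule contrapos_np) (intro summableI_nonneg_bounded[of h L] h0, simp add: not_less)
    then obtain n where n: "L < (\<Sum>k<n. h k)" by blast
    \<comment> \<open>For \<open>|v| < r\<close> the first \<open>n\<close> poles satisfy
      \<open>|b k| + |v| \<le> 2 * |b k|\<close>, so each near one contributes at least
      \<open>c / 2 * h k\<close>.\<close>
    define r where "r = Min (insert (\<epsilon> / 2) ((\<lambda>k. cmod (b k)) ` {..<n}))"
    have r: "0 < r" "r \<le> \<epsilon> / 2" "\<And>k. k < n \<Longrightarrow> r \<le> cmod (b k)"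
    proof -
      show "0 < r" using eps b_nz unfolding r_def by (subst Min_gr_iff) auto
      show "r \<le> \<epsilon> / 2" "\<And>k. k < n \<Longrightarrow> r \<le> cmod (b k)" unfolding r_def by (intro Min_le; simp)+
    qed
    have "1 \<le> cmod (g v)" if v: "0 < cmod v" "cmod v < r" "s \<le> \<bar>Arg v\<bar>" "v \<notin> range b" for v
    proof -
      obtain \<alpha> where \<alpha>: "\<And>k. cmod (b k) \<le> \<epsilon> \<Longrightarrow> c * (cmod (b k) + cmod v) \<le> Re (cis (- \<alpha>) * (b k - v))"
        using near[OF v(3)] by blast
      define f where "f k = cis \<alpha> * (of_real (a k) / (b k - v))" for k
      have S: "summable (\<lambda>k. of_real (a k) / (b k - v) :: complex)" using v r eps by (intro summable_terms) auto
      have sf: "summable f" "suminf f = cis \<alpha> * g v"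
        unfolding f_def g_def by (rule summable_mult[OF S], rule suminf_mult[OF S])
      have fnear: "c * (a k / (cmod (b k) + cmod v)) \<le> Re (f k)" if "cmod (b k) \<le> \<epsilon>" for k
      proof -
        have "b k - v \<noteq> 0" using v(4) by (metis rangeI right_minus_eq)
        then have w: "0 < cmod (b k - v)" by simp
        have t: "cmod (b k - v) \<le> cmod (b k) + cmod v" by (rule norm_triangle_ineq4)
        then have "cmod (b k - v) ^ 2 \<le> (cmod (b k) + cmod v) ^ 2" by (intro power_mono) auto
        then have "c * (a k * (cmod (b k) + cmod v)) / (cmod (b k) + cmod v) ^ 2 \<le> c * (a k * (cmod (b k) + cmod v)) / cmod (b k - v) ^ 2"
          using w t c a_pos[of k] by (intro divide_left_mono mult_pos_pos mult_nonneg_nonneg) auto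
        also have "\<dots> = a k * (c * (cmod (b k) + cmod v)) / cmod (b k - v) ^ 2" by simp
        also have "\<dots> \<le> a k * Re (cis (- \<alpha>) * (b k - v)) / cmod (b k - v) ^ 2"
          using \<alpha>[OF that] a_pos[of k] by (intro divide_right_mono mult_left_mono) auto
        also have "\<dots> = Re (f k)" unfolding f_def Re_mult_divide cis_cnj ..
        finally show ?thesis using w t by (simp add: power2_eq_square)
      qed
      have flow: "- (2 / \<epsilon> * a k) \<le> Re (f k)" for k
      proof (cases "cmod (b k) \<le> \<epsilon>")
        case True
        have "0 \<le> c * (a k / (cmod (b k) + cmod v))" using c a_pos[of k] by (intro mult_nonneg_nonneg divide_nonneg_nonneg) auto
        moreover have "0 \<le> 2 / \<epsilon> * a k" using eps a_pos[of k] by simp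
        ultimately show ?thesis using fnear[OF True] by linarith
      next
        case False
        have "\<epsilon> / 2 \<le> cmod (b k - v)" using False v r norm_triangle_ineq2[of "b k" v] by linarith
        then have "a k / cmod (b k - v) \<le> a k / (\<epsilon> / 2)"
          using a_pos[of k] eps by (intro divide_left_mono mult_pos_pos) auto
        then have "cmod (f k) \<le> 2 / \<epsilon> * a k" using a_pos[of k] by (simp add: f_def norm_mult norm_divide mult_ac)
        then show ?thesis using abs_Re_le_cmod[of "f k"] by linarith
      qed
      have "c / 2 * L \<le> c / 2 * (\<Sum>k<n. h k)" using n c by (intro mult_left_mono) auto
      also have "\<dots> = (\<Sum>k<n. c / 2 * h k)" by (rule sum_distrib_left)
      also have "\<dots> \<le> (\<Sum>k<n. Re (f k) + 2 / \<epsilon> * a k)"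
      proof (rule sum_mono)
        fix k assume k: "k \<in> {..<n}"
        show "c / 2 * h k \<le> Re (f k) + 2 / \<epsilon> * a k"
        proof (cases "cmod (b k) \<le> \<epsilon>")
          case True
          have "cmod v \<le> cmod (b k)" using v r(3)[of k] k by simp
          then have "a k / (2 * cmod (b k)) \<le> a k / (cmod (b k) + cmod v)"
            using a_pos[of k] b_nz[of k] v by (intro divide_left_mono mult_pos_pos add_pos_pos) auto
          then have "c * (a k / (2 * cmod (b k))) \<le> c * (a k / (cmod (b k) + cmod v))" using c by (intro mult_left_mono) auto
          moreover have "c / 2 * h k = c * (a k / (2 * cmod (b k)))" using True by (simp add: h_def)
          moreover have "0 \<le> 2 / \<epsilon> * a k" using eps a_pos[of k] by simp
          ultimately show ?thesis using fnear[OF True] by linarith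
        next
          case False
          then have "c / 2 * h k = 0" by (simp add: h_def)
          then show ?thesis using flow[of k] by linarith
        qed
      qed
      also have "\<dots> \<le> Re (suminf f) + (\<Sum>k. 2 / \<epsilon> * a k)"
        by (rule Re_suminf_ge_sum[OF sf(1) summable_mult[OF a_sum] flow]) simp
      also have "(\<Sum>k. 2 / \<epsilon> * a k) = 2 / \<epsilon> * A" unfolding A_def by (rule suminf_mult[OF a_sum])
      also have "Re (suminf f) \<le> cmod (g v)"
        using complex_Re_le_cmod[of "suminf f"] by (simp add: sf(2) norm_mult)
      finally have "c / 2 * L \<le> cmod (g v) + 2 / \<epsilon> * A" by simp
      moreover have "c / 2 * L = 2 / \<epsilon> * A + 1" using c by (simp add: L_def)
      ultimately show ?thesis by simp
    qed
    then show ?thesis using r by (intro exI[of _ 1] conjI exI[of _ r]) auto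
  qed
qed

lemma zeros_accumulate:
  assumes lim: "0 islimpt range b" and "0 < r"
    and angles: "0 \<le> p" "p \<le> s" "0 < s" "s < t" "t < pi" "p \<le> pi / 2" "\<tau> * t < pi / 2"
    and b_Arg: "\<And>k. cmod (b k) \<le> \<epsilon> \<Longrightarrow> \<bar>Arg (b k)\<bar> \<le> p"
    and "0 < c" "0 < r1"
    and lower: "\<And>v. 0 < cmod v \<Longrightarrow> cmod v < r1 \<Longrightarrow> s \<le> \<bar>Arg v\<bar> \<Longrightarrow> v \<notin> range b \<Longrightarrow> c \<le> cmod (g v)"
  shows "\<exists>v. 0 < cmod v \<and> cmod v < r \<and> v \<notin> range b \<and> g v = 0"
proof (rule ccontr)
  assume no: "\<not> ?thesis"
  define e where "e = min \<epsilon> (min r r1)"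
  have e: "0 < e" "e \<le> \<epsilon>" "e \<le> r" "e \<le> r1" using assms eps by (auto simp: e_def)
  \<comment> \<open>\<open>g\<close> depends on \<open>a\<close> and \<open>b\<close> only, so
    passing to the smaller radius \<open>e\<close> leaves the function unchanged.\<close>
  have "pole_sum a b e \<tau>"
  proof
    show "(\<lambda>k. cmod (b k) powr \<tau>) summable_on {k. cmod (b k) \<le> e}"
      using b_sum by (rule summable_on_subset_banach) (use e in auto)
  qed (use a_pos a_sum b_re eps e \<tau> in auto)
  then have "zero_free_pole_sum a b e \<tau> p s t c"
  proof (rule zero_free_pole_sum.intro, intro zero_free_pole_sum_axioms.intro)
    fix v assume v: "0 < cmod v" "cmod v < e / 2" "v \<notin> range b"
    then have "cmod v < r" using e by linarith
    then show "g v \<noteq> 0" using no v by blast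
  next
    fix v assume v: "0 < cmod v" "cmod v < e / 2" "s \<le> \<bar>Arg v\<bar>" "v \<notin> range b"
    then have "cmod v < r1" using e by linarith
    then show "c \<le> cmod (g v)" using lower v by blast
  qed (use angles b_Arg e \<open>0 < c\<close> in auto)
  then interpret E: zero_free_pole_sum a b e \<tau> p s t c .
  show False using E.no_accumulation lim by blast
qed

end

text \<open>Gauss-Lucas: a hyperplane with normal \<open>u\<close> separates an outside point
  \<open>w\<close> from \<open>D\<close>, and then every term of the series multiplied by
  \<open>u\<close> has positive real part at \<open>w\<close>.\<close>

lemma pole_series_zero_in_convex:
  assumes "open D" "convex D" "\<And>k. z k \<in> D" "\<And>k. 0 < a k" "summable a"
    and zero: "is_zero_of_pole_series a z w"
  shows "w \<in> D"
proof (rule ccontr)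
  assume "w \<notin> D"
  then obtain u B where u: "u \<noteq> 0" "\<And>x. x \<in> D \<Longrightarrow> inner u x \<le> B" "B \<le> inner u w"
    using separating_hyperplane_sets[of D "{w}"] assms(2,3) by force
  have strict: "inner u x < inner u w" if "x \<in> D" for x
  proof -
    from assms(1)[unfolded open_contains_cball, rule_format, OF that]
    obtain e where e: "e > 0" "cball x e \<subseteq> D" by blast
    \<comment> \<open>Openness makes the separation strict: \<open>x\<close> moved by
      \<open>e\<close> in the direction \<open>u\<close> is still in \<open>D\<close>.\<close>
    define y where "y = x + of_real (e / cmod u) * u"
    have "dist x y = e" using e u(1) by (simp add: y_def dist_norm norm_mult norm_divide)
    then have "y \<in> D" using e by auto
    then have "inner u y \<le> B" by (rule u(2))
    moreover have "inner u y = inner u x + e / cmod u * (cmod u)^2"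
      unfolding y_def inner_add_right scaleR_conv_of_real[symmetric] inner_scaleR_right power2_norm_eq_inner ..
    moreover have "0 < e / cmod u * (cmod u)^2" using e u(1) by simp
    ultimately show ?thesis using u(3) by linarith
  qed
  from zero have "w \<notin> closure (range z)" and w0: "pole_series a z w = 0"
    by (auto simp: is_zero_of_pole_series_def)
  then obtain d where d: "d > 0" "\<And>k. d \<le> cmod (w - z k)"
    unfolding closure_approachable by (auto simp: dist_norm norm_minus_commute not_less)
  have S: "summable (\<lambda>k. of_real (a k) / (w - z k) :: complex)"
  proof (rule summable_comparison_test'[OF summable_divide[OF assms(5), of d]])
    show "cmod (of_real (a k) / (w - z k)) \<le> a k / d" for k
      using d(1) d(2)[of k] assms(4)[of k] by (auto simp: norm_divide intro!: divide_left_mono mult_pos_pos)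
  qed
  have pos: "0 < Re (u * (of_real (a k) / (w - z k)))" for k
  proof -
    have "0 < inner u (w - z k)" using strict[OF assms(3)] by (simp add: inner_diff_right)
    then have "0 < Re (cnj u * (w - z k))" by (simp add: inner_complex_def)
    moreover have "0 < cmod (w - z k)" using d(1) d(2)[of k] by linarith
    ultimately show ?thesis unfolding Re_mult_divide using assms(4)[of k] by simp
  qed
  have "summable (\<lambda>k. u * (of_real (a k) / (w - z k)))" by (rule summable_mult[OF S])
  then have "0 < Re (\<Sum>k. u * (of_real (a k) / (w - z k)))"
    using pos by (subst Re_suminf) (auto intro!: suminf_pos summable_Re)
  also have "(\<Sum>k. u * (of_real (a k) / (w - z k))) = 0"
    using suminf_mult[OF S, of u] w0 by (simp add: pole_series_def)
  finally show False by simp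
qed

text \<open>Chooses the angles. If \<open>l < 1\<close>, the half-plane bound works with
  \<open>p = s = pi / 2\<close> and there is room for \<open>t > pi / 2\<close>. If
  \<open>l \<ge> 1\<close>, then \<open>pi / (2 * l) \<le> pi / 2\<close>, and the supremum provides
  a sector of poles strictly narrower than this.\<close>

lemma zeros_near_1:
  assumes Re_less: "\<And>k. Re (z k) < 1" and a: "\<And>k. a k > 0" "summable a"
    and lim: "1 islimpt range z" and \<epsilon>: "\<epsilon> > 0" and l: "l \<ge> 0"
    and sums: "\<And>\<tau>. \<tau> > l \<Longrightarrow> (\<lambda>k. norm (1 - z k) powr \<tau>) summable_on {k. norm (1 - z k) \<le> \<epsilon>}"
    and Args: "(SUP k \<in> {k. norm (1 - z k) \<le> \<epsilon>}. ereal \<bar>Arg (1 - z k)\<bar>) < C_bound l"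
    and "r > 0"
  shows "\<exists>w. dist w 1 < r \<and> is_zero_of_pole_series a z w"
proof -
  define b where "b k = 1 - z k" for k
  define e where "e = min \<epsilon> 1"
  have e: "0 < e" "e \<le> 1" "e \<le> \<epsilon>" using \<epsilon> by (auto simp: e_def)
  have pole: "pole_sum a b e \<tau>" if "\<tau> > l" for \<tau>
  proof
    show "(\<lambda>k. cmod (b k) powr \<tau>) summable_on {k. cmod (b k) \<le> e}"
      using sums[OF that] unfolding b_def[symmetric]
      by (rule summable_on_subset_banach) (use e in auto)
  qed (use a Re_less e that l in \<open>auto simp: b_def\<close>)
  have lim': "0 islimpt range b"
    unfolding islimpt_approachable
  proof (intro allI impI)
    fix d :: real assume "d > 0"
    then obtain k where "z k \<noteq> 1" "dist (z k) 1 < d" using lim unfolding islimpt_approachable by blast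
    then show "\<exists>x'\<in>range b. x' \<noteq> 0 \<and> dist x' 0 < d"
      by (intro bexI[of _ "b k"]) (auto simp: b_def dist_norm norm_minus_commute)
  qed
  have "\<exists>p s t \<tau> c r1. \<tau> > l \<and> 0 \<le> p \<and> p \<le> s \<and> 0 < s \<and> s < t \<and> t < pi \<and> p \<le> pi / 2 \<and> \<tau> * t < pi / 2 \<and>
     (\<forall>k. cmod (b k) \<le> e \<longrightarrow> \<bar>Arg (b k)\<bar> \<le> p) \<and> 0 < c \<and> 0 < r1 \<and>
     (\<forall>v. 0 < cmod v \<longrightarrow> cmod v < r1 \<longrightarrow> s \<le> \<bar>Arg v\<bar> \<longrightarrow> v \<notin> range b \<longrightarrow> c \<le> cmod (pole_sum.g a b v))"
  proof (cases "l < 1")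
    case True
    \<comment> \<open>any \<open>t\<close> between \<open>\<pi> / 2\<close> and \<open>min \<pi> (\<pi> / (2 l))\<close> would do; this one also covers \<open>l = 0\<close>\<close>
    define t where "t = pi * (3 - l) / 4"
    \<comment> \<open>The midpoint of \<open>l\<close> and
      \<open>2 / (3 - l) = pi / (2 * t)\<close>, which are in this order because
      \<open>(1 - l) * (2 - l) > 0\<close>.\<close>
    define \<tau> where "\<tau> = (l + 2 / (3 - l)) / 2"
    have "0 < (1 - l) * (2 - l)" using True by (intro mult_pos_pos) auto
    then have "l < 2 / (3 - l)" using True by (simp add: field_simps)
    then have \<tau>l: "l < \<tau>" "\<tau> < 2 / (3 - l)" by (auto simp: \<tau>_def)
    have t: "pi / 2 < t" "t < pi" using True l by (auto simp: t_def)
    have "\<tau> * t < 2 / (3 - l) * t" using \<tau>l(2) t pi_gt_zero by (intro mult_strict_right_mono) linarith+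
    also have "\<dots> = pi / 2" using True by (simp add: t_def field_simps)
    finally have \<tau>t: "\<tau> * t < pi / 2" .
    interpret pole_sum a b e \<tau> by (rule pole[OF \<tau>l(1)])
    define c where "c = a 0 * Re (b 0) / (cmod (b 0) + 1) ^ 2"
    have c: "0 < c" using a_pos[of 0] b_re[of 0] unfolding c_def by (intro divide_pos_pos mult_pos_pos zero_less_power) (auto intro: add_nonneg_pos)
    have "\<forall>v. 0 < cmod v \<longrightarrow> cmod v < e \<longrightarrow> pi / 2 \<le> \<bar>Arg v\<bar> \<longrightarrow> v \<notin> range b \<longrightarrow> c \<le> cmod (g v)"
    proof (intro allI impI)
      fix v assume v: "0 < cmod v" "cmod v < e" "pi / 2 \<le> \<bar>Arg v\<bar>" "v \<notin> range b"
      have "Re v \<le> 0" using v(3) Arg_Re_pos[of v] by linarith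
      then show "c \<le> cmod (g v)" unfolding c_def using v by (intro lower_bound_left)
    qed
    moreover have "\<bar>Arg (b k)\<bar> \<le> pi / 2" for k using Arg_Re_pos[of "b k"] b_re[of k] by simp
    ultimately show ?thesis using \<tau>l t \<tau>t c e pi_gt_zero
      by - (rule exI[of _ "pi / 2"], rule exI[of _ "pi / 2"], rule exI[of _ t], rule exI[of _ \<tau>],
        rule exI[of _ c], rule exI[of _ e], simp)
  next
    case False
    then have C: "C_bound l = ereal (pi / (2 * l))" by (simp add: C_bound_def)
    obtain p0 where p0: "(SUP k \<in> {k. norm (1 - z k) \<le> \<epsilon>}. ereal \<bar>Arg (1 - z k)\<bar>) < ereal p0" "ereal p0 < ereal (pi / (2 * l))"
      using Args unfolding C by (metis ereal_dense2)
    have Ap: "\<bar>Arg (b k)\<bar> \<le> p0" if "cmod (b k) \<le> e" for k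
    proof -
      have "ereal \<bar>Arg (1 - z k)\<bar> \<le> (SUP k \<in> {k. norm (1 - z k) \<le> \<epsilon>}. ereal \<bar>Arg (1 - z k)\<bar>)"
        using that e by (intro SUP_upper) (auto simp: b_def)
      then have "ereal \<bar>Arg (1 - z k)\<bar> < ereal p0" using p0(1) by (rule le_less_trans)
      then show ?thesis by (simp add: b_def)
    qed
    \<comment> \<open>The \<open>max\<close> supplies \<open>0 \<le> p\<close>, as \<open>p0\<close>
      comes without a sign.\<close>
    define p where "p = max 0 p0"
    define m where "m = pi / (2 * l)"
    \<comment> \<open>Successive midpoints give \<open>p < s < t < m\<close>; then
      \<open>l < pi / (2 * t)\<close> leaves room for \<open>\<tau>\<close>.\<close>
    define s where "s = (p + m) / 2"
    define t where "t = (s + m) / 2"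
    have l1: "1 \<le> l" using False by simp
    have m: "0 < m" "m \<le> pi / 2" using l1 by (auto simp: m_def field_simps)
    have pm: "0 \<le> p" "p < m" using p0(2) m by (auto simp: p_def m_def)
    have st: "p < s" "s < t" "t < m" using pm by (auto simp: s_def t_def)
    have st': "0 < t" "s < pi / 2" "0 < s" "t < pi" "p \<le> pi / 2" using st pm m pi_gt_zero by linarith+
    define \<tau> where "\<tau> = (l + pi / (2 * t)) / 2"
    have "l < pi / (2 * t)" using st(3) st'(1) l1 by (simp add: m_def field_simps)
    then have \<tau>l: "l < \<tau>" "\<tau> < pi / (2 * t)" by (auto simp: \<tau>_def)
    have \<tau>t: "\<tau> * t < pi / 2" using \<tau>l(2) st'(1) by (simp add: field_simps)
    interpret pole_sum a b e \<tau> by (rule pole[OF \<tau>l(1)])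
    have Ap': "\<bar>Arg (b k)\<bar> \<le> p" if "cmod (b k) \<le> e" for k using Ap[OF that] by (simp add: p_def)
    obtain c r1 where "0 < c" "0 < r1" "\<forall>v. 0 < cmod v \<longrightarrow> cmod v < r1 \<longrightarrow> s \<le> \<bar>Arg v\<bar> \<longrightarrow> v \<notin> range b \<longrightarrow> c \<le> cmod (g v)"
      using lower_bound_sector[OF pm(1) st(1) st'(2) Ap'] by blast
    then show ?thesis using \<tau>l st st' \<tau>t pm Ap'
      by - (rule exI[of _ p], rule exI[of _ s], rule exI[of _ t], rule exI[of _ \<tau>],
        rule exI[of _ c], rule exI[of _ r1], simp)
  qed
  then obtain p s t \<tau> c r1 where H: "\<tau> > l" "0 \<le> p" "p \<le> s" "0 < s" "s < t" "t < pi" "p \<le> pi / 2" "\<tau> * t < pi / 2"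
     "\<And>k. cmod (b k) \<le> e \<Longrightarrow> \<bar>Arg (b k)\<bar> \<le> p" "0 < c" "0 < r1"
     "\<And>v. 0 < cmod v \<Longrightarrow> cmod v < r1 \<Longrightarrow> s \<le> \<bar>Arg v\<bar> \<Longrightarrow> v \<notin> range b \<Longrightarrow> c \<le> cmod (pole_sum.g a b v)"
    by (elim exE conjE) blast
  interpret pole_sum a b e \<tau> by (rule pole[OF H(1)])
  obtain v where v: "0 < cmod v" "cmod v < min r e" "v \<notin> range b" "g v = 0"
    using zeros_accumulate[OF lim' _ H(2-12), of "min r e"] \<open>r > 0\<close> e by auto
  obtain d where d: "d > 0" "\<And>k. b k \<noteq> v \<Longrightarrow> d \<le> dist v (b k)" using isolated[OF v(1)] v(2) by auto
  have "1 - v \<notin> closure (range z)"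
  proof
    assume "1 - v \<in> closure (range z)"
    then obtain k where k: "dist (z k) (1 - v) < d" using d(1) unfolding closure_approachable by blast
    have "b k \<noteq> v" using v(3) by (metis rangeI)
    moreover have "dist (z k) (1 - v) = dist v (b k)" by (simp add: dist_norm b_def algebra_simps)
    ultimately show False using d(2)[of k] k by simp
  qed
  moreover have "pole_series a z (1 - v) = 0"
  proof -
    have "pole_series a z (1 - v) = g v" unfolding pole_series_def g_def b_def by (simp add: algebra_simps)
    then show ?thesis using v by simp
  qed
  moreover have "dist (1 - v) 1 < r" using v by (simp add: dist_norm)
  ultimately show ?thesis unfolding is_zero_of_pole_series_def by blast
qed

theorem theorem1p1:
  fixes D :: "complex set"
    and z :: "nat \<Rightarrow> complex"
    and a :: "nat \<Rightarrow> real"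
    and \<epsilon> l :: real
  assumes "D \<subseteq> {w. Re w < 1}"
    and "domain_in_plane D"
    and "convex D"
    and "1 \<in> frontier D"
    and "\<And>k. z k \<in> D"
    and "\<And>k. a k > 0"
    and "summable a"
    and "1 islimpt range z"
    and "\<epsilon> > 0"
    and "l \<ge> 0"
    and "\<And>\<tau>. \<tau> > l \<Longrightarrow>
           (\<lambda>k. norm (1 - z k) powr \<tau>) summable_on {k. norm (1 - z k) \<le> \<epsilon>}"
    and "(SUP k \<in> {k. norm (1 - z k) \<le> \<epsilon>}. ereal \<bar>Arg (1 - z k)\<bar>) < C_bound l"
  shows "\<exists>\<eta> :: nat \<Rightarrow> complex.
           (\<forall>j. \<eta> j \<in> D \<and> is_zero_of_pole_series a z (\<eta> j)) \<and> \<eta> \<longlonglongrightarrow> 1"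
proof -
  have "Re (z k) < 1" for k using assms(1,5) by blast
  then have "\<exists>w. dist w 1 < inverse (real (Suc j)) \<and> is_zero_of_pole_series a z w" for j
    by (rule zeros_near_1[OF _ assms(6-12)]) simp_all
  then obtain \<eta> where \<eta>: "\<And>j. dist (\<eta> j) 1 < inverse (real (Suc j))" "\<And>j. is_zero_of_pole_series a z (\<eta> j)"
    by metis
  have "\<eta> j \<in> D" for j
    using pole_series_zero_in_convex[OF _ assms(3,5,6,7) \<eta>(2)] assms(2) by (auto simp: domain_in_plane_def)
  moreover have "\<eta> \<longlonglongrightarrow> 1"
    by (rule metric_tendsto_imp_tendsto[OF LIMSEQ_inverse_real_of_nat])
       (use \<eta>(1) in \<open>auto intro!: always_eventually less_imp_le simp: dist_norm simp del: of_nat_Suc\<close>)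
  ultimately show ?thesis using \<eta>(2) by blast
qed

end
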